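(* Let $(P,\mathsf{d})$ be an $n$-point metric space and $\alpha\ge 1$. There exists a randomized algorithm (accessing $\mathsf{d}$ via constant-time distance evaluations) which, with high probability, outputs an $O(\ln n)$-approximation to the sparsest $\alpha$-navigable graph on $P$, under both the maximum out-degree and the total-number-of-edges objectives. Letting $\mathrm{OPT}_{\mathrm{size}}$ denote the minimum number of edges of any $\alpha$-navigable graph on $P$, the algorithm runs in time $\widetilde{O}(n\cdot\mathrm{OPT}_{\mathrm{size}})$.
   Context: For $\alpha\ge 1$, a directed graph $G=(P,E)$ on a finite metric space $(P,\mathsf{d})$ is $\alpha$-navigable if for every $s,t\in P$ with $\mathsf{d}(s,t)>0$ there is $u\in P$ with $(s,u)\in E$ and $\mathsf{d}(u,t)<\mathsf{d}(s,t)/\alpha$. An $\alpha$-navigable graph is a $c$-approximation to the sparsest $\alpha$-navigable graph under the maximum out-degree (resp. total-edges) objective if its maximum out-degree (resp. number of edges) is at most $c$ times that of every $\alpha$-navigable graph on $P$. $\widetilde{O}$ hides polylogarithmic factors. *)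

theory Defs
  imports "HOL-Probability.Probability" "HOL-Library.Discrete_Functions"
begin

section \<open>Navigable graphs\<close>

definition navigable :: "'a set \<Rightarrow> ('a \<Rightarrow> 'a \<Rightarrow> real) \<Rightarrow> real \<Rightarrow> ('a \<times> 'a) set \<Rightarrow> bool" where
  "navigable P d \<alpha> E \<longleftrightarrow>
     E \<subseteq> P \<times> P \<and>
     (\<forall>s\<in>P. \<forall>t\<in>P. d s t > 0 \<longrightarrow> (\<exists>u\<in>P. (s, u) \<in> E \<and> d u t < d s t / \<alpha>))"

definition max_outdeg :: "'a set \<Rightarrow> ('a \<times> 'a) set \<Rightarrow> nat" where
  "max_outdeg P E = Max ((\<lambda>s. card {u. (s, u) \<in> E}) ` P)"

definition approx_sparsest_deg ::
  "'a set \<Rightarrow> ('a \<Rightarrow> 'a \<Rightarrow> real) \<Rightarrow> real \<Rightarrow> real \<Rightarrow> ('a \<times> 'a) set \<Rightarrow> bool" where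
  "approx_sparsest_deg P d \<alpha> c E \<longleftrightarrow>
     navigable P d \<alpha> E \<and>
     (\<forall>E'. navigable P d \<alpha> E' \<longrightarrow> real (max_outdeg P E) \<le> c * real (max_outdeg P E'))"

definition approx_sparsest_size ::
  "'a set \<Rightarrow> ('a \<Rightarrow> 'a \<Rightarrow> real) \<Rightarrow> real \<Rightarrow> real \<Rightarrow> ('a \<times> 'a) set \<Rightarrow> bool" where
  "approx_sparsest_size P d \<alpha> c E \<longleftrightarrow>
     navigable P d \<alpha> E \<and>
     (\<forall>E'. navigable P d \<alpha> E' \<longrightarrow> real (card E) \<le> c * real (card E'))"

definition OPT_size :: "'a set \<Rightarrow> ('a \<Rightarrow> 'a \<Rightarrow> real) \<Rightarrow> real \<Rightarrow> nat" where
  "OPT_size P d \<alpha> = Min (card ` {E. navigable P d \<alpha> E})"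


section \<open>Randomized RAM with a distance oracle\<close>

text \<open>
  The machine is a word RAM with words of \<open>\<Theta>(log n)\<close> bits, together with real registers that
  admit field operations and comparisons only (in particular no rounding, so that reals cannot be
  used to smuggle long bit strings into words). Programs are terms of a while language. The points
  of the metric space are presented to a program as the indices \<open>0, \<dots>, n - 1\<close>, and
  distances can be accessed only through the oracle expression \<open>RDist\<close>.
\<close>

record input =
  num_points :: nat
  stretch :: real
  distance :: "nat \<Rightarrow> nat \<Rightarrow> real"

type_synonym vname = nat

record state =
  wvar :: "vname \<Rightarrow> nat"
  warr :: "vname \<Rightarrow> nat \<Rightarrow> nat"
  rvar :: "vname \<Rightarrow> real"
  rarr :: "vname \<Rightarrow> nat \<Rightarrow> real"

datatype wexp =
    WConst nat
  | WSize
  | WVar vname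
  | WArr vname wexp
  | WAdd wexp wexp
  | WSub wexp wexp
  | WMul wexp wexp
  | WDiv wexp wexp

datatype rexp =
    ROfWord wexp
  | RAlpha
  | RDist wexp wexp
  | RVar vname
  | RArr vname wexp
  | RAdd rexp rexp
  | RSub rexp rexp
  | RMul rexp rexp
  | RDiv rexp rexp

datatype bexp =
    BLess wexp wexp
  | BRLess rexp rexp
  | BNot bexp
  | BAnd bexp bexp

datatype com =
    Skip
  | WAssign vname wexp
  | WStore vname wexp wexp
  | RAssign vname rexp
  | RStore vname wexp rexp
  | Rand vname wexp
  | Seq com com
  | Cond bexp com com
  | While bexp com

text \<open>
  All word arithmetic is reduced modulo \<open>2 ^ w\<close>, where the word length \<open>w\<close> is a constant
  multiple \<open>\<kappa>\<close> of the binary length of \<open>n\<close>. Subtraction is truncated at zero.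
\<close>

definition wmod :: "nat \<Rightarrow> input \<Rightarrow> nat" where
  "wmod \<kappa> I = 2 ^ (\<kappa> * (floor_log (num_points I) + 1))"

primrec wval :: "nat \<Rightarrow> input \<Rightarrow> wexp \<Rightarrow> state \<Rightarrow> nat" where
  "wval \<kappa> I (WConst k) s = k mod wmod \<kappa> I"
| "wval \<kappa> I WSize s = num_points I mod wmod \<kappa> I"
| "wval \<kappa> I (WVar x) s = wvar s x"
| "wval \<kappa> I (WArr a e) s = warr s a (wval \<kappa> I e s)"
| "wval \<kappa> I (WAdd e f) s = (wval \<kappa> I e s + wval \<kappa> I f s) mod wmod \<kappa> I"
| "wval \<kappa> I (WSub e f) s = wval \<kappa> I e s - wval \<kappa> I f s"
| "wval \<kappa> I (WMul e f) s = (wval \<kappa> I e s * wval \<kappa> I f s) mod wmod \<kappa> I"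
| "wval \<kappa> I (WDiv e f) s = wval \<kappa> I e s div wval \<kappa> I f s"

definition oracle_dist :: "input \<Rightarrow> nat \<Rightarrow> nat \<Rightarrow> real" where
  "oracle_dist I i j = (if i < num_points I \<and> j < num_points I then distance I i j else 0)"

primrec rval :: "nat \<Rightarrow> input \<Rightarrow> rexp \<Rightarrow> state \<Rightarrow> real" where
  "rval \<kappa> I (ROfWord e) s = real (wval \<kappa> I e s)"
| "rval \<kappa> I RAlpha s = stretch I"
| "rval \<kappa> I (RDist e f) s = oracle_dist I (wval \<kappa> I e s) (wval \<kappa> I f s)"
| "rval \<kappa> I (RVar x) s = rvar s x"
| "rval \<kappa> I (RArr a e) s = rarr s a (wval \<kappa> I e s)"
| "rval \<kappa> I (RAdd p q) s = rval \<kappa> I p s + rval \<kappa> I q s"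
| "rval \<kappa> I (RSub p q) s = rval \<kappa> I p s - rval \<kappa> I q s"
| "rval \<kappa> I (RMul p q) s = rval \<kappa> I p s * rval \<kappa> I q s"
| "rval \<kappa> I (RDiv p q) s = rval \<kappa> I p s / rval \<kappa> I q s"

primrec bval :: "nat \<Rightarrow> input \<Rightarrow> bexp \<Rightarrow> state \<Rightarrow> bool" where
  "bval \<kappa> I (BLess e f) s \<longleftrightarrow> wval \<kappa> I e s < wval \<kappa> I f s"
| "bval \<kappa> I (BRLess p q) s \<longleftrightarrow> rval \<kappa> I p s < rval \<kappa> I q s"
| "bval \<kappa> I (BNot b) s \<longleftrightarrow> \<not> bval \<kappa> I b s"
| "bval \<kappa> I (BAnd b c) s \<longleftrightarrow> bval \<kappa> I b s \<and> bval \<kappa> I c s"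

text \<open>
  One step is one unit of time. A step evaluates at most two expressions of the program text; their
  size is a constant depending on the program alone, so that each step is \<open>O(1)\<close> word
  operations, real operations and distance evaluations. \<open>Rand x e\<close> draws a uniformly random
  element of \<open>{0, \<dots>, m - 1}\<close>, where \<open>m\<close> is the value of \<open>e\<close> (and yields
  0 if \<open>m = 0\<close>).
\<close>

primrec step :: "nat \<Rightarrow> input \<Rightarrow> com \<Rightarrow> state \<Rightarrow> (com \<times> state) pmf" where
  "step \<kappa> I Skip s = return_pmf (Skip, s)"
| "step \<kappa> I (WAssign x e) s =
     return_pmf (Skip, s\<lparr>wvar := (wvar s)(x := wval \<kappa> I e s)\<rparr>)"
| "step \<kappa> I (WStore a e f) s =
     return_pmf (Skip, s\<lparr>warr := (warr s)(a := (warr s a)(wval \<kappa> I e s := wval \<kappa> I f s))\<rparr>)"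
| "step \<kappa> I (RAssign x p) s =
     return_pmf (Skip, s\<lparr>rvar := (rvar s)(x := rval \<kappa> I p s)\<rparr>)"
| "step \<kappa> I (RStore a e p) s =
     return_pmf (Skip, s\<lparr>rarr := (rarr s)(a := (rarr s a)(wval \<kappa> I e s := rval \<kappa> I p s))\<rparr>)"
| "step \<kappa> I (Rand x e) s =
     map_pmf (\<lambda>v. (Skip, s\<lparr>wvar := (wvar s)(x := v)\<rparr>))
       (if wval \<kappa> I e s = 0 then return_pmf 0 else pmf_of_set {..<wval \<kappa> I e s})"
| "step \<kappa> I (Seq c1 c2) s =
     (if c1 = Skip then return_pmf (c2, s)
      else map_pmf (\<lambda>(c1', s'). (Seq c1' c2, s')) (step \<kappa> I c1 s))"
| "step \<kappa> I (Cond b c1 c2) s = return_pmf (if bval \<kappa> I b s then c1 else c2, s)"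
| "step \<kappa> I (While b c) s = return_pmf (if bval \<kappa> I b s then Seq c (While b c) else Skip, s)"

primrec steps :: "nat \<Rightarrow> input \<Rightarrow> nat \<Rightarrow> com \<times> state \<Rightarrow> (com \<times> state) pmf" where
  "steps \<kappa> I 0 cfg = return_pmf cfg"
| "steps \<kappa> I (Suc t) cfg = bind_pmf (step \<kappa> I (fst cfg) (snd cfg)) (steps \<kappa> I t)"

definition init_state :: state where
  "init_state = \<lparr>wvar = (\<lambda>_. 0), warr = (\<lambda>_ _. 0), rvar = (\<lambda>_. 0), rarr = (\<lambda>_ _. 0)\<rparr>"

definition run :: "nat \<Rightarrow> com \<Rightarrow> input \<Rightarrow> nat \<Rightarrow> (com \<times> state) pmf" where
  "run \<kappa> prog I t = steps \<kappa> I t (prog, init_state)"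

text \<open>\<open>Skip\<close> is the only halted command; halted configurations are fixed points of \<open>step\<close>.\<close>

definition halts_within :: "nat \<Rightarrow> com \<Rightarrow> input \<Rightarrow> nat \<Rightarrow> bool" where
  "halts_within \<kappa> prog I t \<longleftrightarrow> (\<forall>cfg \<in> set_pmf (run \<kappa> prog I t). fst cfg = Skip)"

text \<open>
  The output is an explicit edge list: its length is word variable 0, and arrays 0 and 1 hold
  the sources and the targets.
\<close>

definition out_edges :: "state \<Rightarrow> (nat \<times> nat) set" where
  "out_edges s = {(warr s 0 i, warr s 1 i) | i. i < wvar s 0}"

end

theory Submission
  imports Defs
begin

text \<open>
  Finding the out-neighbours of a source \<open>s\<close> is a set cover problem: pick few points \<open>u\<close>
  whose sets \<open>{t. d u t < d s t / \<alpha>}\<close> cover all \<open>t \<noteq> s\<close>. For a guess \<open>k\<close> of the optimum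
  \<open>opt s\<close>, a round draws \<open>L k\<close> random uncovered targets, where \<open>L = \<Theta>(log n)\<close>, and scans
  all points once, picking each one that covers at least \<open>L/2\<close> of the samples not hit so far; this
  makes at most \<open>2k\<close> picks. If more than half of the samples remain unhit, they certify
  \<open>k < opt s\<close>, and \<open>k\<close> is doubled; so \<open>k \<le> 2 opt s\<close> holds in every run, which bounds
  degree and time without any appeal to probability. Otherwise at most \<open>2k\<close> sets hit half of the
  samples, and by a union bound over the families of at most \<open>2k\<close> sets they cover a sixteenth of
  the uncovered targets, with high probability. Hence \<open>O(log n)\<close> rounds suffice.
\<close>

section \<open>A quantitative program logic for the randomized RAM\<close>

text \<open>Sampling is a matter of cost. Exact greedy set cover inspects all pairs of points for
  each source, about n^3 evaluations in total; a scan against \<open>L k\<close> samples costs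
  \<open>n L k\<close>, and with k = O(opt s) this sums over the sources to O(n log n) times the
  optimal size per round. Sources do not interact, so a bound O(log n) opt s on the degree of each
  \<open>s\<close> settles both objectives at once.

  The obstacle is dependence: the picks depend on the samples, and later rounds on earlier ones. The
  union bound therefore runs over families fixed before the draw, and failure is measured by an
  expectation that is carried through the program command by command; conditional probabilities
  never appear.

  Bounds that hold in every run have a second use. Word arithmetic wraps around, so the counters
  must be known not to overflow in unlucky runs as well.

  The number of rounds, 12 \<open>lg\<close>, allows for at most \<open>lg\<close> doublings of the
  guess and leaves 11 \<open>lg\<close> shrinking rounds, which suffice because 2 * 15^11 \<le>
  16^11.\<close>

primrec wmods :: "com \<Rightarrow> vname set" where
  "wmods Skip = {}"
| "wmods (WAssign x e) = {x}"
| "wmods (WStore a e f) = {}"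
| "wmods (RAssign x p) = {}"
| "wmods (RStore a e p) = {}"
| "wmods (Rand x e) = {x}"
| "wmods (Seq c1 c2) = wmods c1 \<union> wmods c2"
| "wmods (Cond b c1 c2) = wmods c1 \<union> wmods c2"
| "wmods (While b c) = wmods c"

primrec amods :: "com \<Rightarrow> vname set" where
  "amods Skip = {}"
| "amods (WAssign x e) = {}"
| "amods (WStore a e f) = {a}"
| "amods (RAssign x p) = {}"
| "amods (RStore a e p) = {}"
| "amods (Rand x e) = {}"
| "amods (Seq c1 c2) = amods c1 \<union> amods c2"
| "amods (Cond b c1 c2) = amods c1 \<union> amods c2"
| "amods (While b c) = amods c"

text \<open>Real registers and real arrays are left out: the program compares distances in place and
  never stores one.\<close>

definition frame :: "com \<Rightarrow> state \<Rightarrow> state \<Rightarrow> bool" where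
  "frame c s s' \<longleftrightarrow> (\<forall>x. x \<notin> wmods c \<longrightarrow> wvar s' x = wvar s x) \<and>
                    (\<forall>a. a \<notin> amods c \<longrightarrow> warr s' a = warr s a)"

lemma frame_refl: "frame c s s"
  by (simp add: frame_def)

lemma frame_trans: "frame c s s' \<Longrightarrow> frame c s' s'' \<Longrightarrow> frame c s s''"
  by (simp add: frame_def)

lemma frame_mono:
  "frame c s s' \<Longrightarrow> wmods c \<subseteq> wmods c' \<Longrightarrow> amods c \<subseteq> amods c' \<Longrightarrow> frame c' s s'"
  by (auto simp: frame_def)

abbreviation set_wvar :: "vname \<Rightarrow> nat \<Rightarrow> state \<Rightarrow> state" where
  "set_wvar x v s \<equiv> s\<lparr>wvar := (wvar s)(x := v)\<rparr>"

abbreviation set_warr :: "vname \<Rightarrow> nat \<Rightarrow> nat \<Rightarrow> state \<Rightarrow> state" where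
  "set_warr a i v s \<equiv> s\<lparr>warr := (warr s)(a := (warr s a)(i := v))\<rparr>"

definition For :: "vname \<Rightarrow> wexp \<Rightarrow> com \<Rightarrow> com" where
  "For i e c = Seq (WAssign i (WConst 0))
     (While (BLess (WVar i) e) (Seq c (WAssign i (WAdd (WVar i) (WConst 1)))))"

lemma wmods_For [simp]: "wmods (For i e c) = insert i (wmods c)"
  by (auto simp: For_def)

lemma amods_For [simp]: "amods (For i e c) = amods c"
  by (auto simp: For_def)

locale ram =
  fixes \<kappa> :: nat and I :: input
begin

text \<open>Besides the frame condition, the residual command may modify no more than the original
  one; this is what lets the property be chained over many steps.\<close>

lemma step_frame:
  "(c', s') \<in> set_pmf (step \<kappa> I c s) \<Longrightarrow>
     wmods c' \<subseteq> wmods c \<and> amods c' \<subseteq> amods c \<and> frame c s s'"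
proof (induction c arbitrary: c' s')
  case (Seq c1 c2)
  show ?case
  proof (cases "c1 = Skip")
    case True
    with Seq.prems show ?thesis by (auto simp: frame_def)
  next
    case False
    with Seq.prems obtain c1' where "(c1', s') \<in> set_pmf (step \<kappa> I c1 s)" "c' = Seq c1' c2"
      by auto
    with Seq.IH(1) show ?thesis by (fastforce simp: frame_def)
  qed
qed (auto simp: frame_def)

lemma steps_frame:
  "cfg' \<in> set_pmf (steps \<kappa> I t cfg) \<Longrightarrow> frame (fst cfg) (snd cfg) (snd cfg')"
proof (induction t arbitrary: cfg)
  case (Suc t)
  then obtain c1 s1 where 1: "(c1, s1) \<in> set_pmf (step \<kappa> I (fst cfg) (snd cfg))"
    and 2: "cfg' \<in> set_pmf (steps \<kappa> I t (c1, s1))"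
    by auto
  from step_frame[OF 1] Suc.IH[OF 2] show ?case
    by (auto intro: frame_trans frame_mono)
qed (simp add: frame_refl)

lemma steps_add: "steps \<kappa> I (t + t') cfg = bind_pmf (steps \<kappa> I t cfg) (steps \<kappa> I t')"
  by (induction t arbitrary: cfg)
     (auto simp: bind_return_pmf bind_assoc_pmf intro!: bind_pmf_cong)

lemma steps_Skip: "steps \<kappa> I t (Skip, s) = return_pmf (Skip, s)"
  by (induction t) (simp_all add: bind_return_pmf)

text \<open>A sure and an average guarantee in one judgement. \<open>Q\<close> holds in every run
  and carries termination, degree bounds and absence of overflow; \<open>g\<close> is a nonnegative
  potential whose final mean is at most \<open>r\<close>. With \<open>g\<close> the indicator of
  failure, \<open>r\<close> bounds the failure probability.\<close>

definition qwp :: "com \<Rightarrow> nat \<Rightarrow> (state \<Rightarrow> bool) \<Rightarrow> (state \<Rightarrow> ennreal) \<Rightarrow> state \<Rightarrow> ennreal \<Rightarrow> bool" where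
  "qwp c T Q g s r \<longleftrightarrow>
     (\<forall>cfg \<in> set_pmf (steps \<kappa> I T (c, s)). fst cfg = Skip \<and> Q (snd cfg)) \<and>
     (\<integral>\<^sup>+cfg. g (snd cfg) \<partial>measure_pmf (steps \<kappa> I T (c, s))) \<le> r"

abbreviation wp :: "com \<Rightarrow> nat \<Rightarrow> (state \<Rightarrow> bool) \<Rightarrow> state \<Rightarrow> bool" where
  "wp c T Q s \<equiv> qwp c T Q (\<lambda>_. 0) s 0"

text \<open>Halted configurations no longer move, so extending the run leaves its final distribution
  unchanged; branches of different length can then share one time bound.\<close>

lemma steps_mono_halted:
  assumes "\<forall>cfg \<in> set_pmf (steps \<kappa> I T cfg0). fst cfg = Skip" "T \<le> T'"
  shows "steps \<kappa> I T' cfg0 = steps \<kappa> I T cfg0"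
proof -
  have "steps \<kappa> I T' cfg0 = bind_pmf (steps \<kappa> I T cfg0) (steps \<kappa> I (T' - T))"
    using assms(2) steps_add[of T "T' - T"] by simp
  also have "\<dots> = bind_pmf (steps \<kappa> I T cfg0) return_pmf"
    using assms(1) by (intro bind_pmf_cong refl) (metis prod.collapse steps_Skip)
  finally show ?thesis by (simp add: bind_return_pmf')
qed

lemma qwp_mono_time: "qwp c T Q g s r \<Longrightarrow> T \<le> T' \<Longrightarrow> qwp c T' Q g s r"
  unfolding qwp_def using steps_mono_halted by metis

lemma qwp_frame: "qwp c T Q g s r \<Longrightarrow> qwp c T (\<lambda>s'. Q s' \<and> frame c s s') g s r"
  unfolding qwp_def using steps_frame by fastforce

lemma qwp_conseq:
  assumes "qwp c T Q g s r" "T \<le> T'" "\<And>s'. Q s' \<Longrightarrow> frame c s s' \<Longrightarrow> Q' s'"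
    "\<And>s'. Q s' \<Longrightarrow> frame c s s' \<Longrightarrow> g' s' \<le> g s'" "r \<le> r'"
  shows "qwp c T' Q' g' s r'"
proof -
  have *: "qwp c T' (\<lambda>s'. Q s' \<and> frame c s s') g s r"
    using assms(1,2) by (intro qwp_frame) (rule qwp_mono_time)
  then have "(\<integral>\<^sup>+cfg. g' (snd cfg) \<partial>measure_pmf (steps \<kappa> I T' (c, s)))
      \<le> (\<integral>\<^sup>+cfg. g (snd cfg) \<partial>measure_pmf (steps \<kappa> I T' (c, s)))"
    by (intro nn_integral_mono_AE AE_pmfI) (auto simp: qwp_def intro: assms(4))
  also have "\<dots> \<le> r'" using * assms(5) by (auto simp: qwp_def)
  finally show ?thesis using * assms(3) by (auto simp: qwp_def)
qed

lemma wp_conseq: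
  assumes "wp c T Q s" "T \<le> T'" "\<And>s'. Q s' \<Longrightarrow> frame c s s' \<Longrightarrow> Q' s'"
  shows "wp c T' Q' s"
  using qwp_conseq[OF assms(1,2), of Q' "\<lambda>_. 0" 0] assms(3) by simp

text \<open>A potential bounded by the constant \<open>r\<close> on all outcomes has mean at most
  \<open>r\<close>, the total mass being 1. This is how deterministic pieces of code enter the
  probabilistic argument.\<close>

lemma qwp_of_wp:
  assumes "wp c T Q s" "T \<le> T'" "\<And>s'. Q s' \<Longrightarrow> frame c s s' \<Longrightarrow> Q' s'"
    "\<And>s'. Q s' \<Longrightarrow> frame c s s' \<Longrightarrow> g s' \<le> r"
  shows "qwp c T' Q' g s r"
proof -
  have *: "wp c T' (\<lambda>s'. Q s' \<and> frame c s s') s"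
    using assms(1,2) by (intro qwp_frame) (rule qwp_mono_time)
  then have "(\<integral>\<^sup>+cfg. g (snd cfg) \<partial>measure_pmf (steps \<kappa> I T' (c, s)))
      \<le> (\<integral>\<^sup>+cfg. r \<partial>measure_pmf (steps \<kappa> I T' (c, s)))"
    by (intro nn_integral_mono_AE AE_pmfI) (auto simp: qwp_def intro: assms(4))
  also have "\<dots> = r" by simp
  finally show ?thesis using * assms(3) by (auto simp: qwp_def)
qed

lemma qwp_Skip: "1 \<le> T \<Longrightarrow> Q s \<Longrightarrow> g s \<le> r \<Longrightarrow> qwp Skip T Q g s r"
  by (simp add: qwp_def steps_Skip nn_integral_return)

lemma qwp_step:
  assumes "step \<kappa> I c s = return_pmf (c', s')" "qwp c' T Q g s' r" "T + 1 \<le> T'"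
  shows "qwp c T' Q g s r"
proof -
  have "qwp c (Suc T) Q g s r"
    using assms(1,2) by (simp add: qwp_def bind_return_pmf)
  then show ?thesis using assms(3) by (rule_tac qwp_mono_time) auto
qed

lemma qwp_WAssign:
  "1 \<le> T \<Longrightarrow> Q (set_wvar x (wval \<kappa> I e s) s) \<Longrightarrow> g (set_wvar x (wval \<kappa> I e s) s) \<le> r \<Longrightarrow>
   qwp (WAssign x e) T Q g s r"
  by (rule qwp_mono_time[of _ 1]) (simp_all add: qwp_def bind_return_pmf nn_integral_return)

lemma qwp_WStore:
  "1 \<le> T \<Longrightarrow> Q (set_warr a (wval \<kappa> I e s) (wval \<kappa> I f s) s) \<Longrightarrow>
   g (set_warr a (wval \<kappa> I e s) (wval \<kappa> I f s) s) \<le> r \<Longrightarrow>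
   qwp (WStore a e f) T Q g s r"
  by (rule qwp_mono_time[of _ 1]) (simp_all add: qwp_def bind_return_pmf nn_integral_return)

lemma qwp_Cond:
  assumes "bval \<kappa> I b s \<Longrightarrow> qwp c1 T Q g s r" "\<not> bval \<kappa> I b s \<Longrightarrow> qwp c2 T Q g s r"
    "T + 1 \<le> T'"
  shows "qwp (Cond b c1 c2) T' Q g s r"
  using assms by (intro qwp_step[of "Cond b c1 c2" s "if bval \<kappa> I b s then c1 else c2" s T]) auto

text \<open>This is the tower property, with \<open>g1\<close> the mean of \<open>g\<close> as seen
  from the intermediate state. Since \<open>c1\<close> may halt at different times in different
  runs, the run cannot be cut at a fixed step; the induction peels off one step of \<open>c1\<close>
  at a time. The inner statement omits \<open>frame\<close> because \<open>c1\<close> changes along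
  the way, and \<open>qwp_frame\<close> restores it at the end.\<close>

lemma qwp_Seq:
  assumes "qwp c1 T1 Q1 g1 s r"
    and c2: "\<And>s'. Q1 s' \<Longrightarrow> frame c1 s s' \<Longrightarrow> qwp c2 T2 Q g s' (g1 s')"
    and T: "T1 + T2 + 1 \<le> T"
  shows "qwp (Seq c1 c2) T Q g s r"
proof -
  have "qwp (Seq c1 c2) (T1 + T2 + 1) Q g s r"
    if "qwp c1 T1 Q1 g1 s r" and c2: "\<And>s'. Q1 s' \<Longrightarrow> qwp c2 T2 Q g s' (g1 s')"
    for Q1 using that(1)
  proof (induction T1 arbitrary: c1 s r)
    case 0
    then have *: "c1 = Skip" "Q1 s" "g1 s \<le> r"
      by (auto simp: qwp_def nn_integral_return)
    show ?case unfolding *(1)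
      by (rule qwp_step[of _ s c2 s T2], simp)
         (use qwp_conseq[OF c2[OF *(2)] order_refl _ _ *(3), of Q g] in auto)
  next
    case (Suc T1)
    show ?case
    proof (cases "c1 = Skip")
      case True
      with Suc.prems have *: "Q1 s" "g1 s \<le> r"
        by (auto simp: qwp_def steps_Skip nn_integral_return simp del: steps.simps)
      show ?thesis unfolding True
        by (rule qwp_step[of _ s c2 s "T1 + T2 + 1"], simp)
           (use qwp_conseq[OF c2[OF *(1)] _ _ _ *(2), of "T1 + T2 + 1" Q g] in auto)
    next
      case False
      \<comment> \<open>\<open>r'\<close> is the conditional mean of \<open>g1\<close> after the
        first step of \<open>c1\<close>; averaged over that step it is at most \<open>r\<close>, and
        it serves as the bound in the induction hypothesis.\<close>
      define r' where "r' cfg = (\<integral>\<^sup>+cfg'. g1 (snd cfg') \<partial>measure_pmf (steps \<kappa> I T1 cfg))" for cfg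
      have IH: "qwp (Seq (fst cfg) c2) (T1 + T2 + 1) Q g (snd cfg) (r' cfg)"
        if "cfg \<in> set_pmf (step \<kappa> I c1 s)" for cfg
        using Suc.prems that by (intro Suc.IH) (auto simp: qwp_def r'_def)
      have st: "steps \<kappa> I (Suc (T1 + T2 + 1)) (Seq c1 c2, s) =
          bind_pmf (step \<kappa> I c1 s) (\<lambda>cfg. steps \<kappa> I (T1 + T2 + 1) (Seq (fst cfg) c2, snd cfg))"
        using False by (simp add: bind_map_pmf split_beta del: add_Suc_right)
      have "(\<integral>\<^sup>+cfg. g (snd cfg) \<partial>measure_pmf (steps \<kappa> I (Suc (T1 + T2 + 1)) (Seq c1 c2, s)))
          \<le> (\<integral>\<^sup>+cfg. r' cfg \<partial>measure_pmf (step \<kappa> I c1 s))"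
        unfolding st nn_integral_bind_pmf using IH[unfolded qwp_def]
        by (intro nn_integral_mono_AE AE_pmfI) (blast dest: conjunct2)
      also have "\<dots> \<le> r"
        using Suc.prems by (simp add: qwp_def r'_def)
      finally show ?thesis
        using IH unfolding add_Suc qwp_def st set_bind_pmf by blast
    qed
  qed
  from this[of "\<lambda>s'. Q1 s' \<and> frame c1 s s'", OF qwp_frame[OF assms(1)]] c2 show ?thesis
    using T by (auto intro: qwp_mono_time)
qed

lemma wp_Seq:
  assumes "wp c1 T1 Q1 s" "\<And>s'. Q1 s' \<Longrightarrow> frame c1 s s' \<Longrightarrow> qwp c2 T2 Q g s' r"
    "T1 + T2 + 1 \<le> T"
  shows "qwp (Seq c1 c2) T Q g s r"
  by (rule qwp_Seq[of c1 T1 Q1 "\<lambda>_. r" s r c2 T2])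
     (use qwp_of_wp[OF assms(1) order_refl] assms(2,3) in auto)

lemma qwp_Seq_WAssign:
  "qwp c T Q g (set_wvar x (wval \<kappa> I e s) s) r \<Longrightarrow> T + 2 \<le> T' \<Longrightarrow>
   qwp (Seq (WAssign x e) c) T' Q g s r"
  by (rule wp_Seq[of "WAssign x e" 1 "\<lambda>s'. s' = set_wvar x (wval \<kappa> I e s) s" s c T])
     (auto intro!: qwp_WAssign)

lemma qwp_Seq_WStore:
  "qwp c T Q g (set_warr a (wval \<kappa> I e s) (wval \<kappa> I f s) s) r \<Longrightarrow> T + 2 \<le> T' \<Longrightarrow>
   qwp (Seq (WStore a e f) c) T' Q g s r"
  by (rule wp_Seq[of "WStore a e f" 1 "\<lambda>s'. s' = set_warr a (wval \<kappa> I e s) (wval \<kappa> I f s) s" s c T])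
     (auto intro!: qwp_WStore)

text \<open>The rule for a random draw: the bounds \<open>h v\<close> for the individual outcomes
  are averaged. The average is stated multiplied by \<open>m\<close>, which keeps division out of
  the side condition.\<close>

lemma qwp_Seq_Rand:
  assumes "wval \<kappa> I e s = m" "m > 0"
    and c: "\<And>v. v < m \<Longrightarrow> qwp c T Q g (set_wvar x v s) (h v)"
    and r: "(\<Sum>v<m. h v) \<le> of_nat m * r"
    and T: "T + 2 \<le> T'"
  shows "qwp (Seq (Rand x e) c) T' Q g s r"
proof -
  let ?D = "pmf_of_set {..<m}"
  have ne: "{..<m} \<noteq> {}" using assms(2) by auto
  have st: "steps \<kappa> I (Suc (Suc T)) (Seq (Rand x e) c, s) =
      bind_pmf ?D (\<lambda>v. steps \<kappa> I T (c, set_wvar x v s))"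
    using assms(1,2) by (simp add: bind_map_pmf bind_return_pmf)
  have "(\<integral>\<^sup>+cfg. g (snd cfg) \<partial>measure_pmf (steps \<kappa> I (Suc (Suc T)) (Seq (Rand x e) c, s)))
      \<le> (\<integral>\<^sup>+v. h v \<partial>measure_pmf ?D)"
    unfolding st nn_integral_bind_pmf using c ne
    by (intro nn_integral_mono_AE AE_pmfI) (auto simp: qwp_def)
  also have "\<dots> = (\<Sum>v<m. h v) / of_nat m"
    using ne by (subst nn_integral_pmf_of_set) (auto simp: ennreal_of_nat_eq_real_of_nat)
  also have "\<dots> \<le> (of_nat m * r) / of_nat m"
    by (intro divide_right_mono_ennreal r)
  also have "\<dots> = r"
    using assms(2) by (simp add: ennreal_mult_divide_eq mult.commute)
  finally have "qwp (Seq (Rand x e) c) (Suc (Suc T)) Q g s r"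
    using c ne assms(2) unfolding qwp_def st by (auto simp: set_pmf_of_set)
  then show ?thesis using T by (rule_tac qwp_mono_time) auto
qed

text \<open>The potential \<open>\<phi>\<close> behaves as a supermartingale: if no iteration raises
  its mean, its final mean is at most its initial value. \<open>Inv\<close> and
  \<open>\<phi>\<close> are evaluated after the counter has been advanced, since the increment
  follows the body. The time \<open>Tb j\<close> may vary with \<open>j\<close>, as the cost of a
  source depends on its optimum. An iteration costs 4 steps beyond the body: the test, the increment
  and two transitions between commands.\<close>

lemma qwp_For:
  assumes inv0: "Inv 0 (set_wvar i 0 s)"
    and bound: "\<And>j s'. j \<le> N \<Longrightarrow> Inv j s' \<Longrightarrow> wvar s' i = j \<Longrightarrow> frame (For i e c) s s' \<Longrightarrow>
      wval \<kappa> I e s' = N"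
    and body: "\<And>j s'. j < N \<Longrightarrow> Inv j s' \<Longrightarrow> wvar s' i = j \<Longrightarrow> frame (For i e c) s s' \<Longrightarrow>
      qwp c (Tb j) (\<lambda>s''. Inv (Suc j) (set_wvar i (Suc j) s''))
        (\<lambda>s''. \<phi> (Suc j) (set_wvar i (Suc j) s'')) s' (\<phi> j s')"
    and i: "i \<notin> wmods c" and N: "N < wmod \<kappa> I"
    and T: "(\<Sum>j<N. Tb j + 4) + 3 \<le> T"
  shows "qwp (For i e c) T (\<lambda>s'. Inv N s' \<and> wvar s' i = N) (\<phi> N) s (\<phi> 0 (set_wvar i 0 s))"
proof -
  let ?inc = "WAssign i (WAdd (WVar i) (WConst 1))"
  let ?W = "While (BLess (WVar i) e) (Seq c ?inc)"
  have W: "qwp ?W ((\<Sum>j=j..<N. Tb j + 4) + 1) (\<lambda>s'. Inv N s' \<and> wvar s' i = N) (\<phi> N) s' (\<phi> j s')"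
    if "j \<le> N" "Inv j s'" "wvar s' i = j" "frame (For i e c) s s'" for j s' using that
  proof (induction "N - j" arbitrary: j s')
    case 0
    then have "j = N" by simp
    with 0 bound[of j s'] show ?case
      by (intro qwp_step[of ?W s' Skip s' 0]) (auto simp: qwp_def nn_integral_return)
  next
    case (Suc m)
    then have j: "j < N" by simp
    have "qwp (Seq c ?inc) (Tb j + 2) (\<lambda>s''. Inv (Suc j) s'' \<and> wvar s'' i = Suc j)
        (\<phi> (Suc j)) s' (\<phi> j s')"
    proof (rule qwp_Seq[OF body[OF j Suc.prems(2-4)]])
      fix s'' assume *: "Inv (Suc j) (set_wvar i (Suc j) s'')" "frame c s' s''"
      have "wvar s'' i = j" using * i Suc.prems by (simp add: frame_def)
      then have "wval \<kappa> I (WAdd (WVar i) (WConst 1)) s'' = Suc j"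
        using j N by (simp add: mod_simps)
      then show "qwp ?inc 1 (\<lambda>s''. Inv (Suc j) s'' \<and> wvar s'' i = Suc j)
        (\<phi> (Suc j)) s'' (\<phi> (Suc j) (set_wvar i (Suc j) s''))"
        using * by (intro qwp_WAssign) auto
    qed simp
    then have "qwp (Seq (Seq c ?inc) ?W) (Tb j + 2 + ((\<Sum>j=Suc j..<N. Tb j + 4) + 1) + 1)
       (\<lambda>s'. Inv N s' \<and> wvar s' i = N) (\<phi> N) s' (\<phi> j s')"
    proof (rule qwp_Seq)
      fix s'' assume *: "Inv (Suc j) s'' \<and> wvar s'' i = Suc j" "frame (Seq c ?inc) s' s''"
      have "frame (For i e c) s s''"
        using Suc.prems(4) by (rule frame_trans) (rule frame_mono[OF *(2)], auto)
      then show "qwp ?W ((\<Sum>j=Suc j..<N. Tb j + 4) + 1)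
       (\<lambda>s'. Inv N s' \<and> wvar s' i = N) (\<phi> N) s'' (\<phi> (Suc j) s'')"
        using * j Suc.hyps(2) by (intro Suc.hyps(1)) auto
    qed simp
    then show ?case
      using j Suc.prems bound[of j s']
      by (intro qwp_step[of ?W s' "Seq (Seq c ?inc) ?W" s' "Tb j + 2 + ((\<Sum>j=Suc j..<N. Tb j + 4) + 1) + 1"])
         (auto simp: sum.atLeast_Suc_lessThan)
  qed
  have "frame (For i e c) s (set_wvar i 0 s)" by (auto simp: frame_def)
  with W[OF _ inv0] have "qwp ?W ((\<Sum>j<N. Tb j + 4) + 1) (\<lambda>s'. Inv N s' \<and> wvar s' i = N) (\<phi> N)
      (set_wvar i 0 s) (\<phi> 0 (set_wvar i 0 s))"
    by (simp add: lessThan_atLeast0)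
  then show ?thesis
    unfolding For_def using T by (intro qwp_Seq_WAssign) auto
qed

lemma wp_For:
  assumes "Inv 0 (set_wvar i 0 s)"
    and "\<And>j s'. j \<le> N \<Longrightarrow> Inv j s' \<Longrightarrow> wvar s' i = j \<Longrightarrow> frame (For i e c) s s' \<Longrightarrow>
      wval \<kappa> I e s' = N"
    and "\<And>j s'. j < N \<Longrightarrow> Inv j s' \<Longrightarrow> wvar s' i = j \<Longrightarrow> frame (For i e c) s s' \<Longrightarrow>
      wp c Tb (\<lambda>s''. Inv (Suc j) (set_wvar i (Suc j) s'')) s'"
    and "i \<notin> wmods c" and "N < wmod \<kappa> I" and "N * (Tb + 4) + 3 \<le> T"
    and "\<And>s'. Inv N s' \<Longrightarrow> wvar s' i = N \<Longrightarrow> frame (For i e c) s s' \<Longrightarrow> Q s'"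
  shows "wp (For i e c) T Q s"
  by (rule wp_conseq[OF qwp_For[where Inv = Inv and N = N and Tb = "\<lambda>_. Tb" and \<phi> = "\<lambda>_ _. 0" and T = T]]) (use assms in auto)

end

section \<open>Navigability as a family of set cover problems\<close>

locale nav_instance =
  fixes n :: nat and d :: "nat \<Rightarrow> nat \<Rightarrow> real" and \<alpha> :: real
  assumes n2: "n \<ge> 2" and metric: "Metric_space {..<n} d" and alpha: "\<alpha> \<ge> 1"
begin

definition reach :: "nat \<Rightarrow> nat \<Rightarrow> nat set" where
  "reach s u = {t. t < n \<and> d u t < d s t / \<alpha>}"

definition hit :: "nat \<Rightarrow> nat set \<Rightarrow> nat set" where
  "hit s W = (\<Union>u\<in>W. reach s u)"

definition covers :: "nat \<Rightarrow> nat set \<Rightarrow> bool" where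
  "covers s W \<longleftrightarrow> {..<n} - {s} \<subseteq> hit s W"

definition opt :: "nat \<Rightarrow> nat" where
  "opt s = (LEAST m. \<exists>W\<subseteq>{..<n}. card W = m \<and> covers s W)"

lemma dist_pos: "s < n \<Longrightarrow> t < n \<Longrightarrow> s \<noteq> t \<Longrightarrow> d s t > 0"
  using Metric_space.mdist_pos_less[OF metric] by simp

lemma dist_pos_iff: "s < n \<Longrightarrow> t < n \<Longrightarrow> d s t > 0 \<longleftrightarrow> s \<noteq> t"
  using dist_pos Metric_space.zero[OF metric, of s t] by fastforce

lemma covers_all:
  assumes "s < n" shows "covers s {..<n}"
proof -
  have "t \<in> reach s t" if "t < n" "t \<noteq> s" for t
    using that assms dist_pos[of s t] alpha Metric_space.zero[OF metric, of t t]
    by (auto simp: reach_def)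
  then show ?thesis by (auto simp: covers_def hit_def)
qed

lemma opt_le: "W \<subseteq> {..<n} \<Longrightarrow> covers s W \<Longrightarrow> opt s \<le> card W"
  unfolding opt_def by (rule Least_le) auto

lemma opt_cover:
  assumes "s < n" obtains W where "W \<subseteq> {..<n}" "card W = opt s" "covers s W"
proof -
  have "\<exists>m. \<exists>W\<subseteq>{..<n}. card W = m \<and> covers s W" using covers_all[OF assms] by blast
  from LeastI_ex[OF this] show ?thesis using that unfolding opt_def by blast
qed

lemma opt_le_n: "s < n \<Longrightarrow> opt s \<le> n"
  using opt_le[OF order_refl covers_all] by simp

text \<open>For n \<ge> 2 there is a target other than \<open>s\<close>, and the empty family hits
  nothing. Hence the starting guess 1 is admissible, and additive terms of the running time can be
  absorbed into multiples of \<open>opt s\<close>.\<close>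

lemma opt_pos:
  assumes "s < n" shows "opt s \<ge> 1"
proof -
  obtain W where W: "W \<subseteq> {..<n}" "card W = opt s" "covers s W" using opt_cover[OF assms] .
  define t where "t = (if s = 0 then 1 else 0 :: nat)"
  have "t < n" "t \<noteq> s" using n2 by (auto simp: t_def)
  with W(3) have "W \<noteq> {}" by (auto simp: covers_def hit_def)
  with W(1,2) show ?thesis by (metis One_nat_def Suc_leI card_gt_0_iff finite_lessThan finite_subset)
qed

text \<open>The condition at a source mentions only the edges that leave it, so navigability splits
  into \<open>n\<close> independent covering conditions. The source drops out of the targets because
  distances vanish exactly on the diagonal.\<close>

lemma navigable_iff:
  "navigable {..<n} d \<alpha> E \<longleftrightarrow>
     E \<subseteq> {..<n} \<times> {..<n} \<and> (\<forall>s<n. covers s {u. (s, u) \<in> E})"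
proof -
  have "(\<forall>s\<in>{..<n}. \<forall>t\<in>{..<n}. d s t > 0 \<longrightarrow> (\<exists>u\<in>{..<n}. (s, u) \<in> E \<and> d u t < d s t / \<alpha>))
      \<longleftrightarrow> (\<forall>s<n. covers s {u. (s, u) \<in> E})" if "E \<subseteq> {..<n} \<times> {..<n}"
  proof -
    have "covers s {u. (s, u) \<in> E} \<longleftrightarrow>
        (\<forall>t\<in>{..<n}. d s t > 0 \<longrightarrow> (\<exists>u\<in>{..<n}. (s, u) \<in> E \<and> d u t < d s t / \<alpha>))"
      if "s < n" for s
    proof -
      have "(\<exists>u\<in>{..<n}. (s, u) \<in> E \<and> d u t < d s t / \<alpha>) \<longleftrightarrow> t \<in> hit s {u. (s, u) \<in> E}"
        if "t < n" for t using that \<open>E \<subseteq> _\<close> by (auto simp: hit_def reach_def)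
      then show ?thesis using that dist_pos_iff[of s] unfolding covers_def by auto
    qed
    then show ?thesis by auto
  qed
  then show ?thesis unfolding navigable_def by blast
qed

lemma card_edges:
  assumes "E \<subseteq> {..<n} \<times> {..<n}"
  shows "card E = (\<Sum>s<n. card {u. (s, u) \<in> E})"
proof -
  have "E = (SIGMA s:{..<n}. {u. (s, u) \<in> E})" using assms by auto
  moreover have "finite {u. (s, u) \<in> E}" for s
    by (rule finite_subset[of _ "{..<n}"]) (use assms in auto)
  ultimately show ?thesis by (metis (no_types, lifting) card_SigmaI finite_lessThan sum.cong)
qed

lemma opt_le_outdeg:
  assumes "navigable {..<n} d \<alpha> E" "s < n" shows "opt s \<le> card {u. (s, u) \<in> E}"
  using assms by (intro opt_le) (auto simp: navigable_iff)

text \<open>The out-neighbourhoods in an optimal graph are covers, one for each source. This turns a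
  cost proportional to \<open>n * opt s\<close> per source into the required output-sensitive
  total.\<close>

lemma sum_opt_le_OPT_size: "(\<Sum>s<n. opt s) \<le> OPT_size {..<n} d \<alpha>"
proof -
  let ?N = "{E. navigable {..<n} d \<alpha> E}"
  have "finite ?N"
    by (rule finite_subset[of _ "Pow ({..<n} \<times> {..<n})"]) (auto simp: navigable_def)
  moreover have "{..<n} \<times> {..<n} \<in> ?N"
    using covers_all by (auto simp: navigable_iff) (auto simp: lessThan_def)
  ultimately have "OPT_size {..<n} d \<alpha> \<in> card ` ?N"
    unfolding OPT_size_def by (intro Min_in) auto
  then obtain E where E: "navigable {..<n} d \<alpha> E" "card E = OPT_size {..<n} d \<alpha>" by auto
  have "(\<Sum>s<n. opt s) \<le> (\<Sum>s<n. card {u. (s, u) \<in> E})"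
    using opt_le_outdeg[OF E(1)] by (intro sum_mono) auto
  also have "\<dots> = card E" using E(1) by (intro card_edges[symmetric]) (auto simp: navigable_def)
  finally show ?thesis using E(2) by simp
qed

text \<open>A degree bound relative to \<open>opt s\<close> at every single source compares with any
  navigable graph source by source; taking the maximum or the sum over the sources yields the two
  objectives.\<close>

lemma approx_sparsest_of_outdeg:
  assumes E: "navigable {..<n} d \<alpha> E"
    and deg: "\<And>s. s < n \<Longrightarrow> real (card {u. (s, u) \<in> E}) \<le> c * real (opt s)"
    and c: "0 \<le> c"
  shows "approx_sparsest_deg {..<n} d \<alpha> c E" "approx_sparsest_size {..<n} d \<alpha> c E"
proof -
  have le: "real (card {u. (s, u) \<in> E}) \<le> c * real (card {u. (s, u) \<in> E'})"
    if "navigable {..<n} d \<alpha> E'" "s < n" for E' s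
    using deg[OF that(2)] opt_le_outdeg[OF that] c
    by (meson mult_left_mono of_nat_mono order_trans)
  show "approx_sparsest_deg {..<n} d \<alpha> c E"
    unfolding approx_sparsest_deg_def
  proof (intro conjI allI impI E)
    fix E' assume E': "navigable {..<n} d \<alpha> E'"
    have "max_outdeg {..<n} E \<in> (\<lambda>s. card {u. (s, u) \<in> E}) ` {..<n}"
      unfolding max_outdeg_def using n2 by (intro Max_in) (auto simp: lessThan_empty_iff)
    then obtain s where s: "s < n" "max_outdeg {..<n} E = card {u. (s, u) \<in> E}" by auto
    have "card {u. (s, u) \<in> E'} \<le> max_outdeg {..<n} E'"
      unfolding max_outdeg_def using s by (intro Max_ge) auto
    then have "c * real (card {u. (s, u) \<in> E'}) \<le> c * real (max_outdeg {..<n} E')"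
      using c by (intro mult_left_mono) auto
    with le[OF E' s(1)] s(2) show "real (max_outdeg {..<n} E) \<le> c * real (max_outdeg {..<n} E')"
      by simp
  qed
  show "approx_sparsest_size {..<n} d \<alpha> c E"
    unfolding approx_sparsest_size_def
  proof (intro conjI allI impI E)
    fix E' assume E': "navigable {..<n} d \<alpha> E'"
    have "real (card E) = (\<Sum>s<n. real (card {u. (s, u) \<in> E}))"
      using E by (subst card_edges) (auto simp: navigable_def)
    also have "\<dots> \<le> (\<Sum>s<n. c * real (card {u. (s, u) \<in> E'}))"
      using le[OF E'] by (intro sum_mono) auto
    also have "\<dots> = c * real (card E')"
      using E' card_edges[of E'] by (simp add: navigable_def sum_distrib_left)
    finally show "real (card E) \<le> c * real (card E')" .
  qed
qed

lemma hit_empty [simp]: "hit s {} = {}"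
  by (simp add: hit_def)

lemma hit_insert [simp]: "hit s (insert u W) = reach s u \<union> hit s W"
  by (simp add: hit_def)

lemma hit_Un: "hit s (W \<union> W') = hit s W \<union> hit s W'"
  by (auto simp: hit_def)

text \<open>Double counting over an optimal cover: its \<open>opt s\<close> sets jointly contain all
  samples outside \<open>X\<close>, more than \<open>L k / 2\<close> of them, but each contains
  fewer than \<open>L / 2\<close>. The argument is deterministic, so the certificate is valid
  however unlucky the samples are.\<close>

lemma opt_gt_of_sample:
  assumes s: "s < n" and R: "\<And>i. i < L * k \<Longrightarrow> R i < n \<and> R i \<noteq> s"
    and few: "\<And>u. u < n \<Longrightarrow> 2 * card {i. i < L * k \<and> R i \<in> reach s u - X} < L"
    and many: "L * k < 2 * card {i. i < L * k \<and> R i \<notin> X}"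
  shows "k < opt s"
proof -
  obtain W where W: "W \<subseteq> {..<n}" "card W = opt s" "covers s W" using opt_cover[OF s] .
  have fW: "finite W" using W(1) finite_subset by blast
  have "{i. i < L * k \<and> R i \<notin> X} \<subseteq> (\<Union>u\<in>W. {i. i < L * k \<and> R i \<in> reach s u - X})"
    using R W(3) by (fastforce simp: covers_def hit_def)
  then have "card {i. i < L * k \<and> R i \<notin> X} \<le> card (\<Union>u\<in>W. {i. i < L * k \<and> R i \<in> reach s u - X})"
    by (intro card_mono) (auto simp: fW)
  also have "\<dots> \<le> (\<Sum>u\<in>W. card {i. i < L * k \<and> R i \<in> reach s u - X})"
    by (rule card_UN_le[OF fW])
  finally have "2 * card {i. i < L * k \<and> R i \<notin> X} \<le> (\<Sum>u\<in>W. 2 * card {i. i < L * k \<and> R i \<in> reach s u - X})"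
    by (simp add: sum_distrib_left[symmetric])
  also have "\<dots> \<le> (\<Sum>u\<in>W. L)"
    using few W(1) by (intro sum_mono less_imp_le) auto
  also have "\<dots> = L * opt s" using W(2) by simp
  finally have "L * k < L * opt s" using many by linarith
  then show ?thesis by simp
qed

end

section \<open>Pessimistic estimator for the sampling step\<close>

text \<open>
  If each \<open>H W\<close> contains at most a sixteenth of the population, a random draw multiplies
  \<open>16 ^ hits\<close> by at most 2 in expectation; \<open>M/2\<close> hits contribute \<open>4 ^ M\<close>.
\<close>

definition estimator :: "'w set \<Rightarrow> ('w \<Rightarrow> nat set) \<Rightarrow> nat \<Rightarrow> nat \<Rightarrow> (nat \<Rightarrow> nat) \<Rightarrow> real" where
  "estimator \<W> H M i r = (\<Sum>W\<in>\<W>. 16 ^ card {j. j < i \<and> r j \<in> H W} * 2 ^ (M - i) / 4 ^ M)"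

lemma estimator_nonneg: "0 \<le> estimator \<W> H M i r"
  unfolding estimator_def by (intro sum_nonneg) auto

lemma estimator_0: "estimator \<W> H M 0 r = card \<W> / 2 ^ M"
  by (simp add: estimator_def power_divide[symmetric] flip: power_one_over)
     (simp add: power_one_over)

text \<open>A single family that contains half of the samples contributes at least 4^M / 4^M. The
  final estimator thus dominates the indicator of the bad event, and its mean bounds the
  probability.\<close>

lemma estimator_final:
  assumes "finite \<W>" "W \<in> \<W>" "M \<le> 2 * card {j. j < M \<and> r j \<in> H W}"
  shows "1 \<le> estimator \<W> H M M r"
proof -
  have "(4::real) ^ M \<le> 4 ^ (2 * card {j. j < M \<and> r j \<in> H W})"
    using assms(3) by (intro power_increasing) auto
  also have "\<dots> = 16 ^ card {j. j < M \<and> r j \<in> H W}" by (simp add: power_mult)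
  finally have "1 \<le> (16::real) ^ card {j. j < M \<and> r j \<in> H W} * 2 ^ (M - M) / 4 ^ M" by simp
  also have "\<dots> \<le> estimator \<W> H M M r"
    unfolding estimator_def using assms by (intro member_le_sum) auto
  finally show ?thesis .
qed

text \<open>The factor 2^(M - i) is a reserve for the draws still to come. Each draw gives up one
  factor 2, against an expected growth of at most 1 + 15/16.\<close>

lemma estimator_step:
  assumes "i < M" and few: "\<And>W. W \<in> \<W> \<Longrightarrow> 16 * card {x. x < m \<and> V x \<in> H W} \<le> m"
  shows "(\<Sum>x<m. estimator \<W> H M (Suc i) (r(i := V x))) \<le> real m * estimator \<W> H M i r"
proof -
  have "(\<Sum>x<m. 16 ^ card {j. j < Suc i \<and> (r(i := V x)) j \<in> H W} * 2 ^ (M - Suc i) / 4 ^ M)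
      \<le> real m * (16 ^ card {j. j < i \<and> r j \<in> H W} * 2 ^ (M - i) / 4 ^ M)" if W: "W \<in> \<W>" for W
  proof -
    let ?c = "card {j. j < i \<and> r j \<in> H W}" and ?A = "{x. x < m \<and> V x \<in> H W}"
    \<comment> \<open>Since 16^0 = 1 and 16^1 = 1 + 15, the new factor is affine in the indicator of
      a hit, and summing over the outcomes reduces to counting hits.\<close>
    have c: "(16::real) ^ card {j. j < Suc i \<and> (r(i := V x)) j \<in> H W}
        = 16 ^ ?c * (1 + 15 * indicator ?A x)" if "x < m" for x
    proof (cases "V x \<in> H W")
      case True
      then have "{j. j < Suc i \<and> (r(i := V x)) j \<in> H W} = insert i {j. j < i \<and> r j \<in> H W}"
        by (auto simp: less_Suc_eq)
      with True that show ?thesis by simp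
    next
      case False
      then have "{j. j < Suc i \<and> (r(i := V x)) j \<in> H W} = {j. j < i \<and> r j \<in> H W}"
        by (auto simp: less_Suc_eq)
      with False that show ?thesis by simp
    qed
    have "(\<Sum>x<m. 16 ^ card {j. j < Suc i \<and> (r(i := V x)) j \<in> H W} * 2 ^ (M - Suc i) / (4::real) ^ M)
        = (\<Sum>x<m. 16 ^ ?c * 2 ^ (M - Suc i) / 4 ^ M * (1 + 15 * indicator ?A x))"
      by (intro sum.cong refl) (simp add: c del: fun_upd_apply)
    also have "\<dots> = 16 ^ ?c * 2 ^ (M - Suc i) / 4 ^ M * (real m + 15 * (\<Sum>x<m. indicator ?A x))"
      by (simp only: sum_distrib_left[symmetric] sum.distrib) simp
    also have "(\<Sum>x<m. indicator ?A x) = real (card ?A)"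
      by (simp add: indicator_def sum.If_cases Int_def)
    also have "16 ^ ?c * 2 ^ (M - Suc i) / 4 ^ M * (real m + 15 * real (card ?A))
        \<le> 16 ^ ?c * 2 ^ (M - Suc i) / 4 ^ M * (real m * 2)"
      using few[OF W] by (intro mult_left_mono) auto
    also have "\<dots> = real m * (16 ^ ?c * 2 ^ (M - i) / 4 ^ M)"
      using assms(1) by (simp add: Suc_diff_Suc[symmetric])
    finally show ?thesis .
  qed
  then show ?thesis
    unfolding estimator_def sum_distrib_left by (subst sum.swap) (rule sum_mono)
qed

section \<open>Counting small families and iterating the shrinkage\<close>

text \<open>A set of at most \<open>q\<close> elements is named by \<open>q\<close> symbols from
  \<open>A\<close> or a blank; the induction strips one symbol, with \<open>None\<close> as the
  blank.\<close>

lemma card_subsets_card_le: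
  assumes "finite A" shows "card {W. W \<subseteq> A \<and> card W \<le> q} \<le> (card A + 1) ^ q"
proof (induction q)
  case 0
  have "{W. W \<subseteq> A \<and> card W \<le> 0} = {{}}" using assms by (auto dest: finite_subset)
  then show ?case by simp
next
  case (Suc q)
  let ?S = "{W. W \<subseteq> A \<and> card W \<le> q}" and ?f = "\<lambda>(x, W). case x of None \<Rightarrow> W | Some a \<Rightarrow> insert a W"
  have fS: "finite ?S" using assms by auto
  have "{W. W \<subseteq> A \<and> card W \<le> Suc q} \<subseteq> ?f ` (insert None (Some ` A) \<times> ?S)"
  proof
    fix W assume W: "W \<in> {W. W \<subseteq> A \<and> card W \<le> Suc q}"
    show "W \<in> ?f ` (insert None (Some ` A) \<times> ?S)"
    proof (cases "W = {}")
      case True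
      then show ?thesis by (intro image_eqI[of _ _ "(None, {})"]) auto
    next
      case False
      then obtain a where a: "a \<in> W" by auto
      with W have "W = ?f (Some a, W - {a})" by auto
      moreover have "card (W - {a}) \<le> q" using W a assms by (auto simp: card_Diff_singleton)
      ultimately show ?thesis using a W by blast
    qed
  qed
  then have "card {W. W \<subseteq> A \<and> card W \<le> Suc q} \<le> card (insert None (Some ` A) \<times> ?S)"
    using assms fS by (meson card_image_le card_mono finite.insertI finite_SigmaI finite_imageI order_trans)
  also have "\<dots> = (card A + 1) * card ?S"
    using assms by (simp add: card_cartesian_product card_image)
  also have "\<dots> \<le> (card A + 1) * (card A + 1) ^ q" by (intro mult_left_mono Suc) auto
  finally show ?case by simp
qed

text \<open>Eleven shrinkings at least halve a set, since 2 * 15^11 \<le> 16^11; after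
  \<open>lg\<close> halvings fewer than n / 2^lg < 1 elements remain. The powers are
  cross-multiplied to stay within the natural numbers.\<close>

lemma shrunk_set_empty:
  assumes "u * 16 ^ b \<le> 15 ^ b * (n::nat)" "11 * lg \<le> b" "n < 2 ^ lg"
  shows "u = 0"
proof (rule ccontr)
  assume "u \<noteq> 0"
  obtain b' where b: "b = 11 * lg + b'" using assms(2) le_Suc_ex by blast
  have "2 ^ lg * 15 ^ b = (2 * 15 ^ 11) ^ lg * (15::nat) ^ b'"
    unfolding b power_add power_mult power_mult_distrib by simp
  also have "\<dots> \<le> (16 ^ 11) ^ lg * 16 ^ b'"
    by (intro mult_mono power_mono) auto
  also have "\<dots> = 16 ^ b" unfolding b power_add power_mult ..
  also have "\<dots> \<le> u * 16 ^ b" using \<open>u \<noteq> 0\<close> by simp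
  also have "\<dots> \<le> 15 ^ b * n" by (rule assms(1))
  finally show False using assms(3) by (simp add: mult.commute)
qed

context nav_instance
begin

text \<open>The range of the union bound: families as small as the picks of a round, but covering
  less than a sixteenth of \<open>U\<close>. It is fixed before the samples are drawn, although the
  picks are not.\<close>

definition light :: "nat \<Rightarrow> nat set \<Rightarrow> nat \<Rightarrow> nat set set" where
  "light s U k = {W. W \<subseteq> {..<n} \<and> card W \<le> 2 * k \<and> 16 * card (hit s W \<inter> U) < card U}"

lemma finite_light: "finite (light s U k)"
  by (rule finite_subset[of _ "Pow {..<n}"]) (auto simp: light_def)

definition misleading :: "nat \<Rightarrow> nat set \<Rightarrow> nat \<Rightarrow> nat \<Rightarrow> (nat \<Rightarrow> nat) \<Rightarrow> bool" where
  "misleading s U k M r \<longleftrightarrow> (\<exists>W\<in>light s U k. M \<le> 2 * card {j. j < M \<and> r j \<in> hit s W})"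

text \<open>There are at most (n + 1)^(2 k) \<le> 2^(2 k lg) light families, while each starts with
  weight 2^-(cL lg k). The two units of \<open>cL\<close> spent here pay for the union bound,
  uniformly in the guess \<open>k\<close>.\<close>

lemma card_light_le:
  assumes "n < 2 ^ lg" "k \<ge> 1" "cL \<ge> 2"
  shows "card (light s U k) / 2 ^ (cL * lg * k) \<le> (1 / 2 :: real) ^ ((cL - 2) * lg)"
proof -
  have "card (light s U k) \<le> card {W. W \<subseteq> {..<n} \<and> card W \<le> 2 * k}"
    by (intro card_mono) (auto simp: light_def)
  also have "\<dots> \<le> (n + 1) ^ (2 * k)" using card_subsets_card_le[of "{..<n}" "2 * k"] by simp
  also have "\<dots> \<le> (2 ^ lg) ^ (2 * k)" using assms(1) by (intro power_mono) auto
  finally have "real (card (light s U k)) \<le> 2 ^ (lg * (2 * k))"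
    by (metis of_nat_le_iff of_nat_numeral of_nat_power power_mult)
  moreover obtain c' where c': "cL = 2 + c'" using assms(3) le_Suc_ex by blast
  ultimately have "card (light s U k) / 2 ^ (cL * lg * k)
     \<le> 2 ^ (lg * (2 * k)) / (2 ^ (lg * (2 * k)) * 2 ^ (c' * lg * k) :: real)"
    unfolding c' distrib_right power_add
    by (intro frac_le) (simp_all add: algebra_simps mult_2 del: power_mult_distrib)
  also have "\<dots> = (1 / 2) ^ (c' * lg * k)" by (simp add: power_one_over)
  also have "\<dots> \<le> (1 / 2) ^ (c' * lg)" using assms(2) by (intro power_decreasing) auto
  finally show ?thesis by (simp add: c')
qed

end

section \<open>The algorithm\<close>

text \<open>\<open>vE\<close>, \<open>aSrc\<close> and \<open>aTgt\<close> are the places from which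
  the output is read, so a pick is appended directly to the output list.\<close>

abbreviation (input) "vE \<equiv> 0 :: vname"
abbreviation (input) "vS \<equiv> 2 :: vname"
abbreviation (input) "vT \<equiv> 3 :: vname"
abbreviation (input) "vI \<equiv> 4 :: vname"
abbreviation (input) "vU \<equiv> 5 :: vname"
abbreviation (input) "vK \<equiv> 6 :: vname"
abbreviation (input) "vM \<equiv> 7 :: vname"
abbreviation (input) "vL \<equiv> 8 :: vname"
abbreviation (input) "vR \<equiv> 9 :: vname"
abbreviation (input) "vJ \<equiv> 10 :: vname"
abbreviation (input) "vLg \<equiv> 11 :: vname"
abbreviation (input) "vX \<equiv> 12 :: vname"
abbreviation (input) "vN \<equiv> 13 :: vname"
abbreviation (input) "vCnt \<equiv> 14 :: vname"
abbreviation (input) "vE0 \<equiv> 15 :: vname"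
abbreviation (input) "vQ \<equiv> 16 :: vname"

abbreviation (input) "aSrc \<equiv> 0 :: vname"
abbreviation (input) "aTgt \<equiv> 1 :: vname"
abbreviation (input) "aCov \<equiv> 2 :: vname"
abbreviation (input) "aUnc \<equiv> 3 :: vname"
abbreviation (input) "aSmp \<equiv> 4 :: vname"
abbreviation (input) "aHit \<equiv> 5 :: vname"

definition near :: "wexp \<Rightarrow> wexp \<Rightarrow> bexp" where
  "near u t = BRLess (RDist u t) (RDiv (RDist (WVar vS) t) RAlpha)"

definition incr :: "vname \<Rightarrow> com" where
  "incr x = WAssign x (WAdd (WVar x) (WConst 1))"

definition count_samples :: "bexp \<Rightarrow> com" where
  "count_samples b = Seq (WAssign vCnt (WConst 0)) (For vI (WVar vM) (Cond b (incr vCnt) Skip))"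

definition mark :: "vname \<Rightarrow> wexp \<Rightarrow> vname \<Rightarrow> bexp \<Rightarrow> com" where
  "mark x e a b = For x e (Cond b (WStore a (WVar x) (WConst 1)) Skip)"

definition list_uncovered :: com where
  "list_uncovered = Seq (WAssign vN (WConst 0))
     (For vT WSize (Cond (BLess (WArr aCov (WVar vT)) (WConst 1))
        (Seq (WStore aUnc (WVar vN) (WVar vT)) (incr vN)) Skip))"

definition draw_samples :: com where
  "draw_samples = For vI (WVar vM) (Seq (Rand vX (WVar vN))
     (Seq (WStore aSmp (WVar vI) (WArr aUnc (WVar vX))) (WStore aHit (WVar vI) (WConst 0))))"

definition try_pick :: com where
  "try_pick =
     Seq (count_samples (BAnd (BLess (WArr aHit (WVar vI)) (WConst 1))
                              (near (WVar vU) (WArr aSmp (WVar vI)))))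
       (Cond (BLess (WAdd (WVar vCnt) (WVar vCnt)) (WVar vL)) Skip
         (Seq (WStore aSrc (WVar vE) (WVar vS))
         (Seq (WStore aTgt (WVar vE) (WVar vU))
         (Seq (incr vE)
           (mark vI (WVar vM) aHit (near (WVar vU) (WArr aSmp (WVar vI))))))))"

definition pick_all :: com where
  "pick_all = Seq (WAssign vE0 (WVar vE)) (For vU WSize try_pick)"

text \<open>Only the points picked in this round, those from position \<open>vE0\<close> on, are
  tested against all targets. That costs O(n k), where refreshing the coverage for every candidate
  would cost n^2.\<close>

definition update_covered :: com where
  "update_covered = For vQ (WSub (WVar vE) (WVar vE0))
     (mark vT WSize aCov (near (WArr aTgt (WAdd (WVar vE0) (WVar vQ))) (WVar vT)))"

definition adjust_guess :: com where
  "adjust_guess = Seq (count_samples (BLess (WArr aHit (WVar vI)) (WConst 1)))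
     (Cond (BLess (WVar vM) (WAdd (WVar vCnt) (WVar vCnt)))
        (WAssign vK (WAdd (WVar vK) (WVar vK))) Skip)"

definition cover_round :: com where
  "cover_round = Seq list_uncovered
     (Cond (BLess (WConst 0) (WVar vN))
        (Seq (WAssign vM (WMul (WVar vL) (WVar vK)))
        (Seq draw_samples (Seq pick_all (Seq update_covered adjust_guess)))) Skip)"

text \<open>The source is marked as covered at the outset: it lies in no set
  \<open>reach s u\<close>, its distance to itself being 0, so it could never be covered by a
  pick.\<close>

definition cover_source :: com where
  "cover_source = Seq (WAssign vK (WConst 1))
     (Seq (For vT WSize (WStore aCov (WVar vT) (WConst 0)))
     (Seq (WStore aCov (WVar vS) (WConst 1))
       (For vJ (WVar vR) cover_round)))"

text \<open>The machine has no logarithm, so the bit length of \<open>n\<close> is found by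
  doubling. Stopping once \<open>n\<close> is exceeded keeps \<open>vX\<close> at most 2 n and so
  within a word.\<close>

definition bit_length :: com where
  "bit_length = Seq (WAssign vX (WConst 1)) (Seq (WAssign vLg (WConst 0))
     (For vI WSize (Cond (BLess WSize (WVar vX)) Skip
        (Seq (WAssign vX (WAdd (WVar vX) (WVar vX))) (incr vLg)))))"

definition nav_prog :: "nat \<Rightarrow> com" where
  "nav_prog cL = Seq bit_length
     (Seq (WAssign vL (WMul (WConst cL) (WVar vLg)))
     (Seq (WAssign vR (WMul (WConst 12) (WVar vLg)))
       (For vS WSize cover_source)))"

lemma mods_incr [simp]: "wmods (incr x) = {x}" "amods (incr x) = {}"
  by (auto simp: incr_def)

lemma mods_count_samples [simp]:
  "wmods (count_samples b) = {vCnt, vI}" "amods (count_samples b) = {}"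
  by (auto simp: count_samples_def)

lemma mods_mark [simp]: "wmods (mark x e a b) = {x}" "amods (mark x e a b) = {a}"
  by (auto simp: mark_def)

lemma mods_list_uncovered [simp]: "wmods list_uncovered = {vT, vN}" "amods list_uncovered = {aUnc}"
  by (auto simp: list_uncovered_def)

lemma mods_draw_samples [simp]:
  "wmods draw_samples = {vI, vX}" "amods draw_samples = {aSmp, aHit}"
  by (auto simp: draw_samples_def)

lemma mods_try_pick [simp]:
  "wmods try_pick = {vE, vI, vCnt}" "amods try_pick = {aSrc, aTgt, aHit}"
  by (auto simp: try_pick_def)

lemma mods_pick_all [simp]:
  "wmods pick_all = {vE, vE0, vU, vI, vCnt}" "amods pick_all = {aSrc, aTgt, aHit}"
  by (auto simp: pick_all_def)

lemma mods_update_covered [simp]: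
  "wmods update_covered = {vQ, vT}" "amods update_covered = {aCov}"
  by (auto simp: update_covered_def)

lemma mods_adjust_guess [simp]:
  "wmods adjust_guess = {vI, vCnt, vK}" "amods adjust_guess = {}"
  by (auto simp: adjust_guess_def)

lemma mods_cover_round [simp]:
  "wmods cover_round = {vT, vN, vM, vI, vX, vE, vE0, vU, vQ, vCnt, vK}"
  "amods cover_round = {aSrc, aTgt, aCov, aUnc, aSmp, aHit}"
  by (auto simp: cover_round_def)

lemma mods_cover_source [simp]:
  "wmods cover_source = {vJ, vT, vN, vM, vI, vX, vE, vE0, vU, vQ, vCnt, vK}"
  "amods cover_source = {aSrc, aTgt, aCov, aUnc, aSmp, aHit}"
  by (auto simp: cover_source_def)

lemma mods_bit_length [simp]: "wmods bit_length = {vX, vLg, vI}" "amods bit_length = {}"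
  by (auto simp: bit_length_def)

text \<open>The two bounds determine \<open>lg\<close> as the bit length of \<open>n\<close>. The
  cube in \<open>word\<close> comes from the crude bound 96 n^3 on the edge counter; the factor
  \<open>cL\<close> leaves room for the number of samples.\<close>

locale nav_ram = nav_instance n d \<alpha> + ram \<kappa> "\<lparr>num_points = n, stretch = \<alpha>, distance = d\<rparr>"
  for n d \<alpha> \<kappa> +
  fixes cL lg :: nat
  assumes lg: "n < 2 ^ lg" "2 ^ lg \<le> 2 * n" and cL2: "cL \<ge> 2"
    and word: "100 * (cL + 1) * n ^ 3 < wmod \<kappa> \<lparr>num_points = n, stretch = \<alpha>, distance = d\<rparr>"
begin

abbreviation "inp \<equiv> \<lparr>num_points = n, stretch = \<alpha>, distance = d\<rparr>"
abbreviation "wlim \<equiv> wmod \<kappa> inp"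

lemma lg_le: "lg \<le> 2 * n"
  using less_exp[of lg] lg by linarith

lemma lg_pos: "lg \<ge> 1"
  using lg n2 by (cases lg) auto

lemma n_le_cube: "n * n \<le> n ^ 3" "n \<le> n ^ 3" "8 \<le> n ^ 3"
proof -
  have "n * n * 1 \<le> n * n * n" "n * 1 * 1 \<le> n * n * n" "2 * 2 * 2 \<le> n * n * n"
    using n2 by (intro mult_mono; simp)+
  then show "n * n \<le> n ^ 3" "n \<le> n ^ 3" "8 \<le> n ^ 3"
    by (simp_all add: power3_eq_cube)
qed

lemma wlim_gt: "100 * n < wlim" "100 < wlim" "100 * n ^ 3 < wlim" "100 * cL * n * n < wlim" "cL < wlim"
proof -
  have 1: "100 * (cL + 1) * n ^ 3 = 100 * cL * n ^ 3 + 100 * n ^ 3" by (simp add: algebra_simps)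
  have 2: "100 * cL * (n * n) \<le> 100 * cL * n ^ 3" "cL * 1 \<le> 100 * cL * n ^ 3"
    using n_le_cube by (intro mult_mono; simp)+
  show "100 * n < wlim" "100 < wlim" "100 * n ^ 3 < wlim" "100 * cL * n * n < wlim" "cL < wlim"
    using word n_le_cube 1 2 unfolding mult.assoc by linarith+
qed

lemma word_consts [simp]:
  "wlim \<noteq> Suc 0" "n mod wlim = n" "Suc 0 mod wlim = Suc 0" "12 mod wlim = 12" "cL mod wlim = cL"
  using wlim_gt by simp_all

lemma bval_near:
  assumes "wval \<kappa> inp u st < n" "wval \<kappa> inp t st < n" "wvar st vS < n"
  shows "bval \<kappa> inp (near u t) st \<longleftrightarrow> wval \<kappa> inp t st \<in> reach (wvar st vS) (wval \<kappa> inp u st)"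
  using assms by (simp add: near_def oracle_dist_def reach_def)

lemma qwp_incr:
  "1 \<le> T \<Longrightarrow> wvar s x + 1 < wlim \<Longrightarrow> Q (set_wvar x (wvar s x + 1) s) \<Longrightarrow>
   g (set_wvar x (wvar s x + 1) s) \<le> r \<Longrightarrow> qwp (incr x) T Q g s r"
  unfolding incr_def by (rule qwp_WAssign) simp_all

section \<open>Elementary loops: counting, marking, listing and drawing\<close>

lemma wp_count_samples:
  assumes M: "wvar s vM = M" "M < wlim"
    and b: "\<And>s' i. i < M \<Longrightarrow> wvar s' vI = i \<Longrightarrow> frame (count_samples b) s s' \<Longrightarrow>
      bval \<kappa> inp b s' \<longleftrightarrow> P i"
    and T: "6 * M + 5 \<le> T"
  shows "wp (count_samples b) T (\<lambda>s'. wvar s' vCnt = card {i. i < M \<and> P i}) s"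
  unfolding count_samples_def
proof (rule qwp_Seq_WAssign[where T = "6 * M + 3"])
  let ?s = "set_wvar vCnt (wval \<kappa> inp (WConst 0) s) s"
  show "wp (For vI (WVar vM) (Cond b (incr vCnt) Skip)) (6 * M + 3)
    (\<lambda>s'. wvar s' vCnt = card {i. i < M \<and> P i}) ?s"
  proof (rule wp_For[where N = M and Tb = 2 and
        Inv = "\<lambda>j s'. wvar s' vCnt = card {i. i < j \<and> P i}"])
    fix j s' assume j: "j < M" and inv: "wvar s' vCnt = card {i. i < j \<and> P i}" and i: "wvar s' vI = j"
      and fr: "frame (For vI (WVar vM) (Cond b (incr vCnt) Skip)) ?s s'"
    have "frame (count_samples b) s s'" using fr by (auto simp: frame_def)
    note b = b[OF j i this]
    have le: "card {i. i < j \<and> P i} \<le> j" using card_mono[of "{..<j}" "{i. i < j \<and> P i}"] by auto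
    have "{i. i < Suc j \<and> P i} = (if P j then insert j {i. i < j \<and> P i} else {i. i < j \<and> P i})"
      by (auto simp: less_Suc_eq)
    then have "card {i. i < Suc j \<and> P i} = (if P j then card {i. i < j \<and> P i} + 1 else card {i. i < j \<and> P i})"
      by simp
    then show "wp (Cond b (incr vCnt) Skip) 2
       (\<lambda>s''. wvar (set_wvar vI (Suc j) s'') vCnt = card {i. i < Suc j \<and> P i}) s'"
      using b inv j le M(2) by (intro qwp_Cond[where T = 1] qwp_incr qwp_Skip) auto
  qed (use M in \<open>auto simp: frame_def\<close>)
qed (use T in auto)

lemma wp_mark:
  assumes N: "\<And>s'. frame (mark x e a b) s s' \<Longrightarrow> wval \<kappa> inp e s' = N" "N < wlim"
    and b: "\<And>s' i. i < N \<Longrightarrow> wvar s' x = i \<Longrightarrow> frame (mark x e a b) s s' \<Longrightarrow>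
      bval \<kappa> inp b s' \<longleftrightarrow> P i"
    and T: "6 * N + 3 \<le> T"
  shows "wp (mark x e a b) T (\<lambda>s'. warr s' a = (\<lambda>i. if i < N \<and> P i then 1 else warr s a i)) s"
  unfolding mark_def
proof (rule wp_For[where N = N and Tb = 2 and
      Inv = "\<lambda>j s'. warr s' a = (\<lambda>i. if i < j \<and> P i then 1 else warr s a i)"])
  fix j s' assume j: "j < N" and inv: "warr s' a = (\<lambda>i. if i < j \<and> P i then 1 else warr s a i)"
    and x: "wvar s' x = j" and fr: "frame (For x e (Cond b (WStore a (WVar x) (WConst 1)) Skip)) s s'"
  note b = b[OF j x fr[folded mark_def]]
  show "wp (Cond b (WStore a (WVar x) (WConst 1)) Skip) 2
     (\<lambda>s''. warr (set_wvar x (Suc j) s'') a = (\<lambda>i. if i < Suc j \<and> P i then 1 else warr s a i)) s'"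
    using b inv x by (intro qwp_Cond[where T = 1] qwp_WStore qwp_Skip) (auto simp: fun_eq_iff less_Suc_eq)
qed (use N T in \<open>auto simp: mark_def\<close>)

text \<open>The bijection makes a uniform index a uniform uncovered target, without repetitions that
  would bias the draw.\<close>

lemma wp_list_uncovered:
  "wp list_uncovered (8 * n + 5)
     (\<lambda>s'. bij_betw (warr s' aUnc) {..<wvar s' vN} {t. t < n \<and> warr s aCov t = 0}) s"
  unfolding list_uncovered_def
proof (rule qwp_Seq_WAssign[where T = "8 * n + 3"])
  let ?c = "Cond (BLess (WArr aCov (WVar vT)) (WConst 1))
        (Seq (WStore aUnc (WVar vN) (WVar vT)) (incr vN)) Skip"
  let ?s = "set_wvar vN (wval \<kappa> inp (WConst 0) s) s"
  let ?U = "\<lambda>j. {t. t < j \<and> warr s aCov t = 0}"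
  show "wp (For vT WSize ?c) (8 * n + 3)
    (\<lambda>s'. bij_betw (warr s' aUnc) {..<wvar s' vN} (?U n)) ?s"
  proof (rule wp_For[where N = n and Tb = 4 and
        Inv = "\<lambda>j s'. bij_betw (warr s' aUnc) {..<wvar s' vN} (?U j)"])
    fix j s' assume j: "j < n" and inv: "bij_betw (warr s' aUnc) {..<wvar s' vN} (?U j)"
      and t: "wvar s' vT = j" and fr: "frame (For vT WSize ?c) ?s s'"
    have cov: "warr s' aCov = warr s aCov" using fr by (simp add: frame_def)
    have "wvar s' vN = card (?U j)" using bij_betw_same_card[OF inv] by simp
    also have "\<dots> \<le> j" using card_mono[of "{..<j}" "?U j"] by auto
    finally have N: "wvar s' vN \<le> j" .
    have U: "?U (Suc j) = (if warr s aCov j = 0 then insert j (?U j) else ?U j)"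
      by (auto simp: less_Suc_eq)
    show "wp ?c 4 (\<lambda>s''. bij_betw (warr (set_wvar vT (Suc j) s'') aUnc)
       {..<wvar (set_wvar vT (Suc j) s'') vN} (?U (Suc j))) s'"
    proof (rule qwp_Cond[where T = 3])
      assume "bval \<kappa> inp (BLess (WArr aCov (WVar vT)) (WConst 1)) s'"
      then have c: "warr s aCov j = 0" using cov t by simp
      have "bij_betw ((warr s' aUnc)(wvar s' vN := j)) (insert (wvar s' vN) {..<wvar s' vN}) (insert j (?U j))"
      proof (rule bij_betw_combine[of _ "{wvar s' vN}" "{j}" "{..<wvar s' vN}" "?U j", simplified])
        show "bij_betw ((warr s' aUnc)(wvar s' vN := j)) {..<wvar s' vN} (?U j)"
          using inv by (subst bij_betw_cong[where g = "warr s' aUnc"]) auto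
      qed (auto simp: bij_betw_def)
      then show "wp (Seq (WStore aUnc (WVar vN) (WVar vT)) (incr vN)) 3
        (\<lambda>s''. bij_betw (warr (set_wvar vT (Suc j) s'') aUnc)
          {..<wvar (set_wvar vT (Suc j) s'') vN} (?U (Suc j))) s'"
        using c t N j wlim_gt
        by (intro qwp_Seq_WStore[where T = 1] qwp_incr) (simp_all add: U lessThan_Suc)
    next
      assume "\<not> bval \<kappa> inp (BLess (WArr aCov (WVar vT)) (WConst 1)) s'"
      then have c: "warr s aCov j \<noteq> 0" using cov t by simp
      then show "wp Skip 3 (\<lambda>s''. bij_betw (warr (set_wvar vT (Suc j) s'') aUnc)
          {..<wvar (set_wvar vT (Suc j) s'') vN} (?U (Suc j))) s'"
        using inv by (intro qwp_Skip) (simp_all add: U)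
    qed simp
  qed (use wlim_gt in \<open>auto simp: bij_betw_def\<close>)
qed simp

text \<open>The loop potential is the estimator on the samples drawn so far. It starts at the number
  of families over 2^M, and \<open>estimator_step\<close> is exactly the averaging condition of a
  draw.\<close>

lemma qwp_draw_samples:
  assumes M: "wvar s vM = M" "M < wlim" and m: "wvar s vN = m" "0 < m"
    and few: "\<And>W. W \<in> \<W> \<Longrightarrow> 16 * card {x. x < m \<and> warr s aUnc x \<in> H W} \<le> m"
  shows "qwp draw_samples (9 * M + 3)
     (\<lambda>s'. \<forall>i<M. warr s' aSmp i \<in> warr s aUnc ` {..<m} \<and> warr s' aHit i = 0)
     (\<lambda>s'. ennreal (estimator \<W> H M M (warr s' aSmp))) s (ennreal (card \<W> / 2 ^ M))"
proof -
  let ?c = "Seq (Rand vX (WVar vN))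
     (Seq (WStore aSmp (WVar vI) (WArr aUnc (WVar vX))) (WStore aHit (WVar vI) (WConst 0)))"
  let ?\<phi> = "\<lambda>j s'. ennreal (estimator \<W> H M j (warr s' aSmp))"
  let ?Inv = "\<lambda>j s'. \<forall>i<j. warr s' aSmp i \<in> warr s aUnc ` {..<m} \<and> warr s' aHit i = 0"
  have "qwp (For vI (WVar vM) ?c) (9 * M + 3)
     (\<lambda>s'. ?Inv M s' \<and> wvar s' vI = M) (?\<phi> M) s (?\<phi> 0 (set_wvar vI 0 s))"
  proof (rule qwp_For[where Tb = "\<lambda>_. 5"])
    fix j s' assume j: "j < M" and inv: "?Inv j s'" and i: "wvar s' vI = j"
      and fr: "frame (For vI (WVar vM) ?c) s s'"
    from fr have eq: "wvar s' vN = m" "warr s' aUnc = warr s aUnc"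
      using m by (simp_all add: frame_def)
    show "qwp ?c 5 (\<lambda>s''. ?Inv (Suc j) (set_wvar vI (Suc j) s''))
       (\<lambda>s''. ?\<phi> (Suc j) (set_wvar vI (Suc j) s'')) s' (?\<phi> j s')"
    proof (rule qwp_Seq_Rand[where T = 3 and m = m and
          h = "\<lambda>v. ennreal (estimator \<W> H M (Suc j) ((warr s' aSmp)(j := warr s aUnc v)))"])
      fix v assume "v < m"
      then show "qwp (Seq (WStore aSmp (WVar vI) (WArr aUnc (WVar vX))) (WStore aHit (WVar vI) (WConst 0))) 3
         (\<lambda>s''. ?Inv (Suc j) (set_wvar vI (Suc j) s''))
         (\<lambda>s''. ?\<phi> (Suc j) (set_wvar vI (Suc j) s'')) (set_wvar vX v s')
         (ennreal (estimator \<W> H M (Suc j) ((warr s' aSmp)(j := warr s aUnc v))))"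
        using inv i eq by (intro qwp_Seq_WStore[where T = 1] qwp_WStore) (auto simp: less_Suc_eq)
    next
      have "(\<Sum>v<m. ennreal (estimator \<W> H M (Suc j) ((warr s' aSmp)(j := warr s aUnc v))))
          = ennreal (\<Sum>v<m. estimator \<W> H M (Suc j) ((warr s' aSmp)(j := warr s aUnc v)))"
        by (intro sum_ennreal estimator_nonneg)
      also have "\<dots> \<le> ennreal (real m * estimator \<W> H M j (warr s' aSmp))"
        by (intro ennreal_leI estimator_step j few)
      also have "\<dots> = of_nat m * ?\<phi> j s'"
        by (simp add: ennreal_mult estimator_nonneg ennreal_of_nat_eq_real_of_nat)
      finally show "(\<Sum>v<m. ennreal (estimator \<W> H M (Suc j) ((warr s' aSmp)(j := warr s aUnc v))))
          \<le> of_nat m * ?\<phi> j s'" .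
    qed (use eq m in auto)
  qed (use M in \<open>auto simp: frame_def\<close>)
  then show ?thesis
    unfolding draw_samples_def by (rule qwp_conseq) (auto simp: estimator_0)
qed

end

lemma out_edges_append:
  assumes "wvar st' vE = Suc (wvar st vE)"
    "\<And>p. p < wvar st vE \<Longrightarrow> warr st' aSrc p = warr st aSrc p \<and> warr st' aTgt p = warr st aTgt p"
    "warr st' aSrc (wvar st vE) = a" "warr st' aTgt (wvar st vE) = b"
  shows "out_edges st' = insert (a, b) (out_edges st)"
proof -
  have "out_edges st' = (\<lambda>p. (warr st' aSrc p, warr st' aTgt p)) ` {..<Suc (wvar st vE)}"
    using assms(1) by (auto simp: out_edges_def)
  also have "\<dots> = insert (a, b) ((\<lambda>p. (warr st' aSrc p, warr st' aTgt p)) ` {..<wvar st vE})"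
    using assms(3,4) by (simp add: lessThan_Suc)
  also have "(\<lambda>p. (warr st' aSrc p, warr st' aTgt p)) ` {..<wvar st vE} =
      (\<lambda>p. (warr st aSrc p, warr st aTgt p)) ` {..<wvar st vE}"
    using assms(2) by (intro image_cong) auto
  also have "\<dots> = out_edges st" by (auto simp: out_edges_def)
  finally show ?thesis .
qed

lemma out_edges_cong:
  "wvar st' vE = wvar st vE \<Longrightarrow> warr st' aSrc = warr st aSrc \<Longrightarrow> warr st' aTgt = warr st aTgt \<Longrightarrow>
   out_edges st' = out_edges st"
  by (simp add: out_edges_def)

section \<open>The greedy pass over one set of samples\<close>

context nav_ram
begin

definition picks :: "nat \<Rightarrow> state \<Rightarrow> nat set" where
  "picks e st = warr st aTgt ` {e..<wvar st vE}"

text \<open>The product inequality charges every pick to at least \<open>L / 2\<close> freshly hit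
  samples. The last conjunct says that points already scanned stay below the threshold, so a single
  pass ends with no eligible point. Picks are counted by list positions, since \<open>picks\<close>
  as a set would hide repetitions.\<close>

definition pick_inv ::
  "nat \<Rightarrow> nat \<Rightarrow> (nat \<times> nat) set \<Rightarrow> (nat \<Rightarrow> nat) \<Rightarrow> nat \<Rightarrow> nat \<Rightarrow> nat \<Rightarrow> state \<Rightarrow> bool" where
  "pick_inv s e E0 R M L j st \<longleftrightarrow>
     e \<le> wvar st vE \<and> out_edges st = E0 \<union> {s} \<times> picks e st \<and> picks e st \<subseteq> {..<n} \<and>
     (\<forall>i<M. warr st aHit i = (if R i \<in> hit s (picks e st) then 1 else 0)) \<and>
     (wvar st vE - e) * L \<le> 2 * card {i. i < M \<and> R i \<in> hit s (picks e st)} \<and>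
     (\<forall>u<j. 2 * card {i. i < M \<and> R i \<in> reach s u - hit s (picks e st)} < L)"

lemma card_samples_le: "card {i. i < M \<and> P i} \<le> (M :: nat)"
  using card_mono[of "{..<M}" "{i. i < M \<and> P i}"] by auto

text \<open>The batches charged to the picks are disjoint, and only \<open>L k\<close> samples
  exist.\<close>

lemma pick_inv_count:
  assumes "pick_inv s e E0 R (L * k) L j st" "L \<ge> 1"
  shows "wvar st vE \<le> e + 2 * k"
proof -
  have "(wvar st vE - e) * L \<le> 2 * card {i. i < L * k \<and> R i \<in> hit s (picks e st)}"
    using assms(1) by (simp add: pick_inv_def)
  also have "\<dots> \<le> 2 * k * L" using card_samples_le[of "L * k"] by (simp add: mult.commute)
  finally show ?thesis using assms(2) by simp
qed

lemma pick_inv_cong: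
  assumes "pick_inv s e E0 R M L j st" "wvar st' vE = wvar st vE"
    "warr st' aSrc = warr st aSrc" "warr st' aTgt = warr st aTgt" "warr st' aHit = warr st aHit"
  shows "pick_inv s e E0 R M L j st'"
  using assms out_edges_cong[of st' st] by (simp add: pick_inv_def picks_def)

lemma pick_inv_step:
  assumes inv: "pick_inv s e E0 R M L u st" and u: "u < n" and L: "L \<ge> 1"
    and c: "L \<le> 2 * card {i. i < M \<and> R i \<in> reach s u - hit s (picks e st)}"
    and st': "wvar st' vE = Suc (wvar st vE)"
    "\<And>p. p < wvar st vE \<Longrightarrow> warr st' aSrc p = warr st aSrc p \<and> warr st' aTgt p = warr st aTgt p"
    "warr st' aSrc (wvar st vE) = s" "warr st' aTgt (wvar st vE) = u"
    "\<And>i. i < M \<Longrightarrow> warr st' aHit i = (if R i \<in> reach s u then 1 else warr st aHit i)"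
  shows "pick_inv s e E0 R M L (Suc u) st'"
proof -
  let ?W = "picks e st"
  have e: "e \<le> wvar st vE" using inv by (simp add: pick_inv_def)
  then have "{e..<wvar st' vE} = insert (wvar st vE) {e..<wvar st vE}" using st'(1) by auto
  moreover have "warr st' aTgt ` {e..<wvar st vE} = ?W"
    unfolding picks_def using st'(2) by (intro image_cong) auto
  ultimately have W': "picks e st' = insert u ?W" using st'(4) by (simp add: picks_def)
  have E: "out_edges st' = insert (s, u) (out_edges st)"
    by (rule out_edges_append) (use st' in auto)
  have "{i. i < M \<and> R i \<in> hit s (insert u ?W)} =
      {i. i < M \<and> R i \<in> hit s ?W} \<union> {i. i < M \<and> R i \<in> reach s u - hit s ?W}" by auto
  then have "card {i. i < M \<and> R i \<in> hit s (insert u ?W)} =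
      card {i. i < M \<and> R i \<in> hit s ?W} + card {i. i < M \<and> R i \<in> reach s u - hit s ?W}"
    by (simp only:) (rule card_Un_disjoint, auto)
  with inv c have cnt: "(Suc (wvar st vE) - e) * L \<le> 2 * card {i. i < M \<and> R i \<in> hit s (insert u ?W)}"
    using e by (simp add: pick_inv_def Suc_diff_le)
  \<comment> \<open>The point just picked leaves none of its samples unhit, so its count is 0 <
    \<open>L\<close>; for points scanned earlier the counts only fall as more samples are
    hit.\<close>
  have few: "2 * card {i. i < M \<and> R i \<in> reach s u' - hit s (insert u ?W)} < L" if "u' < Suc u" for u'
  proof (cases "u' = u")
    case True
    then have "{i. i < M \<and> R i \<in> reach s u' - hit s (insert u ?W)} = {}" by auto
    then have "card {i. i < M \<and> R i \<in> reach s u' - hit s (insert u ?W)} = 0"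
      by (simp only: card.empty)
    with L show ?thesis by linarith
  next
    case False
    have "card {i. i < M \<and> R i \<in> reach s u' - hit s (insert u ?W)}
        \<le> card {i. i < M \<and> R i \<in> reach s u' - hit s ?W}" by (intro card_mono) auto
    with inv False that show ?thesis by (fastforce simp: pick_inv_def less_Suc_eq)
  qed
  show ?thesis
    unfolding pick_inv_def W' st'(1)
  proof (intro conjI)
    show "out_edges st' = E0 \<union> {s} \<times> insert u ?W" using E inv by (auto simp: pick_inv_def)
    show "\<forall>i<M. warr st' aHit i = (if R i \<in> hit s (insert u ?W) then 1 else 0)"
      using st'(5) inv by (simp add: pick_inv_def)
    show "insert u ?W \<subseteq> {..<n}" using inv u by (simp add: pick_inv_def)
  qed (use e cnt few in auto)
qed

lemma wp_try_pick:
  assumes inv: "pick_inv s e E0 R (L * k) L u st" and u: "wvar st vU = u" "u < n"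
    and s: "wvar st vS = s" "s < n" and L: "wvar st vL = L" "L \<ge> 1"
    and M: "wvar st vM = L * k" "2 * (L * k) < wlim" and e: "e + 2 * k + 1 < wlim"
    and R: "warr st aSmp = R" "\<And>i. i < L * k \<Longrightarrow> R i < n"
  shows "wp try_pick (12 * (L * k) + 16) (pick_inv s e E0 R (L * k) L (Suc u)) st"
proof -
  let ?M = "L * k" and ?W = "picks e st"
  let ?b = "BAnd (BLess (WArr aHit (WVar vI)) (WConst 1)) (near (WVar vU) (WArr aSmp (WVar vI)))"
  let ?c = "card {i. i < ?M \<and> R i \<in> reach s u - hit s ?W}"
  have "wp (count_samples ?b) (6 * ?M + 5) (\<lambda>s'. wvar s' vCnt = ?c) st"
  proof (rule wp_count_samples)
    fix s' i assume i: "i < ?M" "wvar s' vI = i" and fr: "frame (count_samples ?b) st s'"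
    have "bval \<kappa> inp (near (WVar vU) (WArr aSmp (WVar vI))) s' \<longleftrightarrow> R i \<in> reach s u"
      using i fr u s R by (subst bval_near) (auto simp: frame_def)
    moreover have "warr s' aHit i = (if R i \<in> hit s ?W then 1 else 0)"
      using i fr inv by (simp add: frame_def pick_inv_def)
    ultimately show "bval \<kappa> inp ?b s' \<longleftrightarrow> R i \<in> reach s u - hit s ?W"
      using i by auto
  qed (use M in auto)
  then show ?thesis
    unfolding try_pick_def
  proof (rule wp_Seq[where ?T2.0 = "6 * ?M + 10"])
    fix s1 assume cnt: "wvar s1 vCnt = ?c" and fr: "frame (count_samples ?b) st s1"
    have inv1: "pick_inv s e E0 R ?M L u s1"
      using fr by (intro pick_inv_cong[OF inv]) (simp_all add: frame_def)
    have W1: "picks e s1 = ?W" using fr by (simp add: picks_def frame_def)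
    have v1: "wvar s1 vU = u" "wvar s1 vS = s" "wvar s1 vL = L" "wvar s1 vM = ?M" "warr s1 aSmp = R"
      using fr u s L M R by (simp_all add: frame_def)
    have e1: "wvar s1 vE + 1 < wlim" using pick_inv_count[OF inv1] L e by simp
    have c2: "wval \<kappa> inp (WAdd (WVar vCnt) (WVar vCnt)) s1 = 2 * ?c"
      using cnt card_samples_le[of ?M "\<lambda>i. R i \<in> reach s u - hit s ?W"] M(2) by simp
    let ?mark = "mark vI (WVar vM) aHit (near (WVar vU) (WArr aSmp (WVar vI)))"
    show "wp (Cond (BLess (WAdd (WVar vCnt) (WVar vCnt)) (WVar vL)) Skip
         (Seq (WStore aSrc (WVar vE) (WVar vS))
         (Seq (WStore aTgt (WVar vE) (WVar vU))
         (Seq (incr vE) ?mark)))) (6 * ?M + 10) (pick_inv s e E0 R ?M L (Suc u)) s1"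
    proof (rule qwp_Cond[where T = "6 * ?M + 9"])
      assume "bval \<kappa> inp (BLess (WAdd (WVar vCnt) (WVar vCnt)) (WVar vL)) s1"
      then have "2 * ?c < L" using c2 v1 by simp
      then show "wp Skip (6 * ?M + 9) (pick_inv s e E0 R ?M L (Suc u)) s1"
        using inv1 by (intro qwp_Skip) (auto simp: pick_inv_def W1 less_Suc_eq)
    next
      assume "\<not> bval \<kappa> inp (BLess (WAdd (WVar vCnt) (WVar vCnt)) (WVar vL)) s1"
      then have c: "L \<le> 2 * ?c" using c2 v1 by simp
      let ?s2 = "set_wvar vE (Suc (wvar s1 vE)) (set_warr aTgt (wvar s1 vE) u (set_warr aSrc (wvar s1 vE) s s1))"
      have "wp ?mark (6 * ?M + 3)
         (\<lambda>s'. warr s' aHit = (\<lambda>i. if i < ?M \<and> R i \<in> reach s u then 1 else warr ?s2 aHit i)) ?s2"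
      proof (rule wp_mark)
        fix s' i assume i: "i < ?M" "wvar s' vI = i" and fr: "frame ?mark ?s2 s'"
        show "bval \<kappa> inp (near (WVar vU) (WArr aSmp (WVar vI))) s' \<longleftrightarrow> R i \<in> reach s u"
          using i fr v1 R u(2) s(2) by (subst bval_near) (auto simp: frame_def)
      qed (use M v1 in \<open>auto simp: frame_def\<close>)
      then have "wp ?mark (6 * ?M + 3) (pick_inv s e E0 R ?M L (Suc u)) ?s2"
        by (rule wp_conseq)
           (use c in \<open>auto intro!: pick_inv_step[OF inv1 u(2) L(2)] simp: W1 frame_def\<close>)
      then show "wp (Seq (WStore aSrc (WVar vE) (WVar vS))
         (Seq (WStore aTgt (WVar vE) (WVar vU))
         (Seq (incr vE) ?mark))) (6 * ?M + 9) (pick_inv s e E0 R ?M L (Suc u)) s1"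
        using v1 e1 unfolding incr_def
        by (intro qwp_Seq_WStore[where T = "6 * ?M + 7"] qwp_Seq_WStore[where T = "6 * ?M + 5"]
              qwp_Seq_WAssign[where T = "6 * ?M + 3"]) simp_all
    qed simp
  qed simp
qed

lemma wp_pick_all:
  assumes e: "wvar st vE = e" "e + 2 * k + 1 < wlim"
    and s: "wvar st vS = s" "s < n" and L: "wvar st vL = L" "L \<ge> 1"
    and M: "wvar st vM = L * k" "2 * (L * k) < wlim"
    and R: "warr st aSmp = R" "\<And>i. i < L * k \<Longrightarrow> R i < n"
    and H: "\<And>i. i < L * k \<Longrightarrow> warr st aHit i = 0"
  shows "wp pick_all (n * (12 * (L * k) + 20) + 5)
     (\<lambda>st'. pick_inv s e (out_edges st) R (L * k) L n st' \<and> wvar st' vE0 = e) st"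
  unfolding pick_all_def
proof (rule qwp_Seq_WAssign[where T = "n * (12 * (L * k) + 20) + 3"])
  let ?s = "set_wvar vE0 (wval \<kappa> inp (WVar vE) st) st"
  let ?Inv = "pick_inv s e (out_edges st) R (L * k) L"
  show "wp (For vU WSize try_pick) (n * (12 * (L * k) + 20) + 3)
     (\<lambda>st'. ?Inv n st' \<and> wvar st' vE0 = e) ?s"
  proof (rule wp_For[where N = n and Inv = ?Inv and Tb = "12 * (L * k) + 16"])
    show "?Inv 0 (set_wvar vU 0 ?s)"
      using e H out_edges_cong[of "set_wvar vU 0 ?s" st] by (simp add: pick_inv_def picks_def)
  next
    fix j s' assume j: "j < n" and inv: "?Inv j s'" and u: "wvar s' vU = j"
      and fr: "frame (For vU WSize try_pick) ?s s'"
    have "wp try_pick (12 * (L * k) + 16) (?Inv (Suc j)) s'"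
      using assms fr by (intro wp_try_pick[OF inv u j]) (auto simp: frame_def)
    then show "wp try_pick (12 * (L * k) + 16) (\<lambda>s''. ?Inv (Suc j) (set_wvar vU (Suc j) s'')) s'"
      by (rule wp_conseq) (auto intro: pick_inv_cong)
  next
    fix s' assume "?Inv n s'" "frame (For vU WSize try_pick) ?s s'"
    then show "?Inv n s' \<and> wvar s' vE0 = e" using e by (simp add: frame_def)
  qed (use wlim_gt in auto)
qed simp

lemma wp_update_covered:
  assumes e: "wvar st vE0 = e" "e \<le> wvar st vE" "wvar st vE \<le> e + q" "wvar st vE < wlim"
    and s: "wvar st vS = s" "s < n" and W: "picks e st \<subseteq> {..<n}"
  shows "wp update_covered (q * (6 * n + 7) + 3)
     (\<lambda>st'. \<forall>t<n. warr st' aCov t = (if t \<in> hit s (picks e st) then 1 else warr st aCov t)) st"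
  unfolding update_covered_def
proof (rule wp_For[where N = "wvar st vE - e" and Tb = "6 * n + 3" and
    Inv = "\<lambda>j st'. \<forall>t<n. warr st' aCov t = (if t \<in> hit s (warr st aTgt ` {e..<e + j}) then 1 else warr st aCov t)"])
  let ?mark = "mark vT WSize aCov (near (WArr aTgt (WAdd (WVar vE0) (WVar vQ))) (WVar vT))"
  let ?H = "\<lambda>j. hit s (warr st aTgt ` {e..<e + j})"
  fix j s' assume j: "j < wvar st vE - e"
    and inv: "\<forall>t<n. warr s' aCov t = (if t \<in> ?H j then 1 else warr st aCov t)"
    and q: "wvar s' vQ = j" and fr: "frame (For vQ (WSub (WVar vE) (WVar vE0)) ?mark) st s'"
  let ?u = "warr st aTgt (e + j)"
  have u: "?u < n" using W j by (auto simp: picks_def image_subset_iff)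
  have H: "?H (Suc j) = reach s ?u \<union> ?H j"
    by (simp add: atLeastLessThanSuc)
  have "wp ?mark (6 * n + 3)
       (\<lambda>s''. warr s'' aCov = (\<lambda>t. if t < n \<and> t \<in> reach s ?u then 1 else warr s' aCov t)) s'"
  proof (rule wp_mark)
    fix s'' t assume t: "t < n" "wvar s'' vT = t" and fr': "frame ?mark s' s''"
    have "wval \<kappa> inp (WArr aTgt (WAdd (WVar vE0) (WVar vQ))) s'' = ?u"
      using fr fr' e j q by (simp add: frame_def)
    then show "bval \<kappa> inp (near (WArr aTgt (WAdd (WVar vE0) (WVar vQ))) (WVar vT)) s'' \<longleftrightarrow> t \<in> reach s ?u"
      using fr fr' t u s by (subst bval_near) (auto simp: frame_def)
  qed (use wlim_gt in auto)
  then show "wp ?mark (6 * n + 3) (\<lambda>s''. \<forall>t<n. warr (set_wvar vQ (Suc j) s'') aCov t =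
      (if t \<in> ?H (Suc j) then 1 else warr st aCov t)) s'"
    by (rule wp_conseq) (use inv H in auto)
next
  show "(wvar st vE - e) * (6 * n + 3 + 4) + 3 \<le> q * (6 * n + 7) + 3"
    using e by (intro add_right_mono mult_mono) auto
qed (use e in \<open>auto simp: frame_def picks_def\<close>)

lemma wp_adjust_guess:
  assumes k: "wvar st vK = k" "2 * k < wlim" and M: "wvar st vM = M" "2 * M < wlim"
    and H: "\<And>i. i < M \<Longrightarrow> warr st aHit i = (if R i \<in> X then 1 else 0)"
  shows "wp adjust_guess (6 * M + 8)
     (\<lambda>st'. wvar st' vK = (if M < 2 * card {i. i < M \<and> R i \<notin> X} then 2 * k else k)) st"
proof -
  let ?b = "BLess (WArr aHit (WVar vI)) (WConst 1)"
  let ?c = "card {i. i < M \<and> R i \<notin> X}"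
  have "wp (count_samples ?b) (6 * M + 5) (\<lambda>s'. wvar s' vCnt = ?c) st"
    by (rule wp_count_samples) (use M H in \<open>auto simp: frame_def\<close>)
  then show ?thesis
    unfolding adjust_guess_def
  proof (rule wp_Seq[where ?T2.0 = 2])
    fix s1 assume cnt: "wvar s1 vCnt = ?c" and fr: "frame (count_samples ?b) st s1"
    have v: "wvar s1 vK = k" "wvar s1 vM = M" using fr k M by (simp_all add: frame_def)
    have c2: "wval \<kappa> inp (WAdd (WVar vCnt) (WVar vCnt)) s1 = 2 * ?c"
      using cnt card_samples_le[of M "\<lambda>i. R i \<notin> X"] M(2) by simp
    show "wp (Cond (BLess (WVar vM) (WAdd (WVar vCnt) (WVar vCnt)))
        (WAssign vK (WAdd (WVar vK) (WVar vK))) Skip) 2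
        (\<lambda>st'. wvar st' vK = (if M < 2 * ?c then 2 * k else k)) s1"
      using v c2 k(2) by (intro qwp_Cond[where T = 1] qwp_WAssign qwp_Skip) auto
  qed simp
qed

end

text \<open>The total mass is 1. The constant holds failures that have already occurred, or the
  reserve for later ones, while a step is analysed on its own.\<close>

lemma (in ram) qwp_add_const:
  "qwp c T Q g s r \<Longrightarrow> qwp c T Q (\<lambda>s'. a + g s') s (a + r)"
  by (auto simp: qwp_def nn_integral_add intro: add_left_mono)

section \<open>Rounds at one source: sure bounds and likely progress\<close>

context nav_ram
begin

definition uncovered :: "state \<Rightarrow> nat set" where
  "uncovered st = {t. t < n \<and> warr st aCov t = 0}"

text \<open>The part that holds in every run. A round makes at most 2 k \<le> 4 \<open>opt s\<close>
  picks, whence the increment. List length and neighbour set are bounded separately: the former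
  guards against overflow, the latter gives the degree.\<close>

definition round_inv :: "nat \<Rightarrow> nat \<Rightarrow> (nat \<times> nat) set \<Rightarrow> nat \<Rightarrow> state \<Rightarrow> bool" where
  "round_inv s e E0 j st \<longleftrightarrow>
     1 \<le> wvar st vK \<and> wvar st vK \<le> 2 * opt s \<and> wvar st vE \<le> e + 4 * opt s * j \<and>
     (\<exists>W\<subseteq>{..<n}. card W \<le> 4 * opt s * j \<and> out_edges st = E0 \<union> {s} \<times> W \<and>
        (\<forall>t<n. warr st aCov t = (if t = s \<or> t \<in> hit s W then 1 else 0)))"

text \<open>
  Of the first \<open>j\<close> rounds, \<open>a\<close> doubled the guess and \<open>b\<close> covered a sixteenth of what was left.
\<close>

definition progress :: "nat \<Rightarrow> state \<Rightarrow> bool" where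
  "progress j st \<longleftrightarrow> (\<exists>a b. a + b = j \<and> wvar st vK = 2 ^ a \<and>
     card (uncovered st) * 16 ^ b \<le> 15 ^ b * n)"

lemma progressI:
  "a + b = j \<Longrightarrow> wvar st vK = 2 ^ a \<Longrightarrow> card (uncovered st) * 16 ^ b \<le> 15 ^ b * n \<Longrightarrow> progress j st"
  unfolding progress_def by blast

lemma finite_uncovered: "finite (uncovered st)"
  by (simp add: uncovered_def)

lemma round_inv_cong:
  assumes "round_inv s e E0 j st" "wvar st' vK = wvar st vK" "wvar st' vE = wvar st vE"
    "warr st' aSrc = warr st aSrc" "warr st' aTgt = warr st aTgt" "warr st' aCov = warr st aCov"
  shows "round_inv s e E0 j st'"
  using assms out_edges_cong[of st' st] by (simp add: round_inv_def)

lemma progress_cong: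
  "wvar st' vK = wvar st vK \<Longrightarrow> warr st' aCov = warr st aCov \<Longrightarrow> progress j st' = progress j st"
  by (simp add: progress_def uncovered_def)

lemma round_inv_Suc: "round_inv s e E0 j st \<Longrightarrow> round_inv s e E0 (Suc j) st"
  unfolding round_inv_def by (elim conjE exE, intro conjI exI) (assumption | simp)+

text \<open>Once the samples are fixed, the rest of the round is deterministic. Chance enters only
  through whether \<open>R\<close> is misleading; if it is not, either the guess doubles or the
  uncovered set shrinks.\<close>

lemma wp_process_samples:
  assumes inv: "round_inv s e E0 j st" and s: "wvar st vS = s" "s < n"
    and L: "wvar st vL = L" "L \<ge> 1" and k: "wvar st vK = k"
    and M: "wvar st vM = L * k" "2 * (L * k) < wlim"
    and R: "warr st aSmp = R" "\<And>i. i < L * k \<Longrightarrow> R i \<in> uncovered st"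
    and H: "\<And>i. i < L * k \<Longrightarrow> warr st aHit i = 0"
    and e: "e + 4 * opt s * Suc j + 1 < wlim"
  shows "wp (Seq pick_all (Seq update_covered adjust_guess))
     (n * (12 * (L * k) + 20) + 2 * k * (6 * n + 7) + 6 * (L * k) + 20)
     (\<lambda>st'. round_inv s e E0 (Suc j) st' \<and>
        (progress j st \<longrightarrow> \<not> misleading s (uncovered st) k (L * k) R \<longrightarrow> progress (Suc j) st')) st"
proof -
  let ?M = "L * k" and ?e = "wvar st vE" and ?U = "uncovered st"
  let ?Q = "\<lambda>st'. round_inv s e E0 (Suc j) st' \<and>
        (progress j st \<longrightarrow> \<not> misleading s ?U k ?M R \<longrightarrow> progress (Suc j) st')"
  obtain W where W: "W \<subseteq> {..<n}" "card W \<le> 4 * opt s * j" "out_edges st = E0 \<union> {s} \<times> W"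
    "\<And>t. t < n \<Longrightarrow> warr st aCov t = (if t = s \<or> t \<in> hit s W then 1 else 0)"
    using inv unfolding round_inv_def by blast
  have k2: "1 \<le> k" "k \<le> 2 * opt s" and e2: "?e \<le> e + 4 * opt s * j"
    using inv k by (auto simp: round_inv_def)
  have lim: "?e + 2 * k + 1 < wlim" using k2 e2 e by (simp add: algebra_simps)
  have Rn: "R i < n \<and> R i \<noteq> s" if "i < ?M" for i
    using R(2)[OF that] W(4)[of s] s(2) by (auto simp: uncovered_def)
  have "wp pick_all (n * (12 * ?M + 20) + 5)
     (\<lambda>st'. pick_inv s ?e (out_edges st) R ?M L n st' \<and> wvar st' vE0 = ?e) st"
    using lim s L M R H Rn by (intro wp_pick_all) auto
  then show ?thesis
  proof (rule wp_Seq[where ?T2.0 = "2 * k * (6 * n + 7) + 6 * ?M + 12"])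
    fix s1 assume "pick_inv s ?e (out_edges st) R ?M L n s1 \<and> wvar s1 vE0 = ?e"
      and fr1: "frame pick_all st s1"
    then have p1: "pick_inv s ?e (out_edges st) R ?M L n s1" and e0: "wvar s1 vE0 = ?e" by auto
    let ?W' = "picks ?e s1"
    have cnt: "wvar s1 vE \<le> ?e + 2 * k" using pick_inv_count[OF p1 L(2)] .
    have W': "?W' \<subseteq> {..<n}" "out_edges s1 = out_edges st \<union> {s} \<times> ?W'" "?e \<le> wvar s1 vE"
      "\<And>i. i < ?M \<Longrightarrow> warr s1 aHit i = (if R i \<in> hit s ?W' then 1 else 0)"
      "\<And>u. u < n \<Longrightarrow> 2 * card {i. i < ?M \<and> R i \<in> reach s u - hit s ?W'} < L"
      using p1 by (auto simp: pick_inv_def)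
    have cW': "card ?W' \<le> 2 * k"
      unfolding picks_def using card_image_le[of "{?e..<wvar s1 vE}" "warr s1 aTgt"] cnt by simp
    have v1: "wvar s1 vS = s" "wvar s1 vK = k" "wvar s1 vM = ?M" "warr s1 aCov = warr st aCov"
      using fr1 s k M by (simp_all add: frame_def)
    have "wp update_covered (2 * k * (6 * n + 7) + 3)
       (\<lambda>st'. \<forall>t<n. warr st' aCov t = (if t \<in> hit s ?W' then 1 else warr s1 aCov t)) s1"
      using e0 cnt W' v1 s(2) lim by (intro wp_update_covered) auto
    then show "wp (Seq update_covered adjust_guess) (2 * k * (6 * n + 7) + 6 * ?M + 12) ?Q s1"
    proof (rule wp_Seq[where ?T2.0 = "6 * ?M + 8"])
      fix s2 assume "\<forall>t<n. warr s2 aCov t = (if t \<in> hit s ?W' then 1 else warr s1 aCov t)"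
        and fr2: "frame update_covered s1 s2"
      then have cov2: "\<And>t. t < n \<Longrightarrow> warr s2 aCov t = (if t \<in> hit s ?W' then 1 else warr st aCov t)"
        using v1 by simp
      let ?c = "card {i. i < ?M \<and> R i \<notin> hit s ?W'}"
      let ?k' = "if ?M < 2 * ?c then 2 * k else k"
      have "2 * k < wlim" using lim by simp
      then have "wp adjust_guess (6 * ?M + 8) (\<lambda>st'. wvar st' vK = ?k') s2"
        using fr2 v1 M W' by (intro wp_adjust_guess) (auto simp: frame_def)
      then show "wp adjust_guess (6 * ?M + 8) ?Q s2"
      proof (rule wp_conseq)
        fix s3 assume k3: "wvar s3 vK = ?k'" and fr3: "frame adjust_guess s2 s3"
        have v3: "wvar s3 vE = wvar s1 vE" "warr s3 aCov = warr s2 aCov"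
          and E3: "out_edges s3 = out_edges s1"
          using fr2 fr3 out_edges_cong[of s3 s1] by (simp_all add: frame_def)
        have U3: "uncovered s3 = ?U - hit s ?W'"
          using cov2 v3 by (auto simp: uncovered_def split: if_splits)
        \<comment> \<open>Doubling happens only with a certificate that \<open>k\<close> is below
          the optimum, so 2 k still respects the bound 2 \<open>opt s\<close>.\<close>
        have dbl: "k < opt s" if "?M < 2 * ?c"
          using opt_gt_of_sample[OF s(2) Rn W'(5) that] .
        have "round_inv s e E0 (Suc j) s3"
          unfolding round_inv_def
        proof (intro conjI exI[of _ "W \<union> ?W'"])
          show "1 \<le> wvar s3 vK" "wvar s3 vK \<le> 2 * opt s" using k2 k3 dbl by auto
          show "wvar s3 vE \<le> e + 4 * opt s * Suc j" using v3 cnt k2 e2 by simp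
          show "W \<union> ?W' \<subseteq> {..<n}" using W W' by auto
          show "card (W \<union> ?W') \<le> 4 * opt s * Suc j"
            using card_Un_le[of W ?W'] W(2) cW' k2 by simp
          show "out_edges s3 = E0 \<union> {s} \<times> (W \<union> ?W')" using E3 W'(2) W(3) by auto
          show "\<forall>t<n. warr s3 aCov t = (if t = s \<or> t \<in> hit s (W \<union> ?W') then 1 else 0)"
            using v3 cov2 W(4) by (auto simp: hit_Un)
        qed
        moreover have "progress (Suc j) s3" if pr: "progress j st" and nm: "\<not> misleading s ?U k ?M R"
        proof -
          from pr obtain a b where ab: "a + b = j" "k = 2 ^ a" "card ?U * 16 ^ b \<le> 15 ^ b * n"
            using k by (auto simp: progress_def)
          show ?thesis
          proof (cases "?M < 2 * ?c")
            case True
            have "card (uncovered s3) * 16 ^ b \<le> card ?U * 16 ^ b"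
              unfolding U3 by (intro mult_right_mono card_mono finite_uncovered) auto
            then have "card (uncovered s3) * 16 ^ b \<le> 15 ^ b * n" using ab(3) by linarith
            with True k3 ab(1,2) show ?thesis
              by (intro progressI[of "Suc a" b]) auto
          next
            case False
            have "{i. i < ?M \<and> R i \<in> hit s ?W'} = {..<?M} - {i. i < ?M \<and> R i \<notin> hit s ?W'}" by auto
            then have "card {i. i < ?M \<and> R i \<in> hit s ?W'} = ?M - ?c"
              by (simp only:) (subst card_Diff_subset, auto)
            \<comment> \<open>At most 2 k picks hit half of the samples. As \<open>R\<close> is not
              misleading, they cannot form a light family, so they cover at least a sixteenth of
              \<open>?U\<close>.\<close>
            then have "?M \<le> 2 * card {i. i < ?M \<and> R i \<in> hit s ?W'}" using False by simp
            with nm have "?W' \<notin> light s ?U k" unfolding misleading_def by blast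
            then have "card ?U \<le> 16 * card (hit s ?W' \<inter> ?U)"
              using W'(1) cW' by (auto simp: light_def)
            moreover have "card (uncovered s3) = card ?U - card (hit s ?W' \<inter> ?U)"
              unfolding U3 using card_Diff_subset_Int[of ?U "hit s ?W'"]
              by (simp add: finite_uncovered Int_commute)
            ultimately have "16 * card (uncovered s3) \<le> 15 * card ?U" by simp
            then have "16 * card (uncovered s3) * 16 ^ b \<le> 15 * card ?U * 16 ^ b"
              by (rule mult_right_mono) simp
            also have "\<dots> \<le> 15 * (15 ^ b * n)" using ab(3) by simp
            finally show ?thesis
              using k3 False ab(1,2) by (intro progressI[of a "Suc b"]) (auto simp: mult_ac)
          qed
        qed
        ultimately show "?Q s3" by blast
      qed simp
    qed simp
  qed simp
qed

definition round_time :: "nat \<Rightarrow> nat" where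
  "round_time k = 8 * n + 9 * (cL * lg * k) + n * (12 * (cL * lg * k) + 20) + 2 * k * (6 * n + 7)
     + 6 * (cL * lg * k) + 40"

lemma round_time_mono: "k \<le> k' \<Longrightarrow> round_time k \<le> round_time k'"
  unfolding round_time_def by (intro add_mono mult_mono order_refl) auto

definition fail_prob :: ennreal where
  "fail_prob = ennreal ((1 / 2) ^ ((cL - 2) * lg))"

text \<open>The potential is the indicator that progress has been lost. Its mean grows by at most
  \<open>fail_prob\<close> per round, whatever happened before, so no conditioning on earlier
  success is required.\<close>

lemma qwp_cover_round:
  assumes inv: "round_inv s e E0 j st" and s: "wvar st vS = s" "s < n"
    and L: "wvar st vL = cL * lg" and e: "e + 4 * opt s * Suc j + 1 < wlim"
  shows "qwp cover_round (round_time (2 * opt s)) (round_inv s e E0 (Suc j))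
     (\<lambda>st'. if progress (Suc j) st' then 0 else 1) st ((if progress j st then 0 else 1) + fail_prob)"
proof -
  let ?k = "wvar st vK" and ?U = "uncovered st"
  let ?M = "cL * lg * ?k"
  let ?r = "(if progress j st then 0 else 1) + fail_prob"
  let ?g = "\<lambda>st'. if progress (Suc j) st' then 0 else 1 :: ennreal"
  have k2: "1 \<le> ?k" "?k \<le> 2 * opt s" using inv by (auto simp: round_inv_def)
  have L1: "cL * lg \<ge> 1" using cL2 lg_pos by simp
  have "?M \<le> cL * (2 * n) * (2 * n)"
    using lg_le k2 opt_le_n[OF s(2)] by (intro mult_mono) auto
  also have "\<dots> = 4 * (cL * n * n)" by simp
  finally have M: "2 * ?M < wlim" using wlim_gt(4) unfolding mult.assoc by linarith
  have "wp list_uncovered (8 * n + 5)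
     (\<lambda>s'. bij_betw (warr s' aUnc) {..<wvar s' vN} {t. t < n \<and> warr st aCov t = 0}) st"
    by (rule wp_list_uncovered)
  then have "qwp cover_round (round_time ?k) (round_inv s e E0 (Suc j)) ?g st ?r"
    unfolding cover_round_def
  proof (rule wp_Seq[where ?T2.0 = "9 * ?M + n * (12 * ?M + 20) + 2 * ?k * (6 * n + 7) + 6 * ?M + 30"])
    fix s1 assume bij: "bij_betw (warr s1 aUnc) {..<wvar s1 vN} {t. t < n \<and> warr st aCov t = 0}"
      and fr1: "frame list_uncovered st s1"
    let ?m = "wvar s1 vN"
    have bij: "bij_betw (warr s1 aUnc) {..<?m} ?U" using bij by (simp add: uncovered_def)
    have m: "card ?U = ?m" using bij_betw_same_card[OF bij] by simp
    have v1: "wvar s1 vS = s" "wvar s1 vL = cL * lg" "wvar s1 vK = ?k" "warr s1 aCov = warr st aCov"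
      using fr1 s L by (simp_all add: frame_def)
    have inv1: "round_inv s e E0 j s1"
      using fr1 by (intro round_inv_cong[OF inv]) (simp_all add: frame_def)
    have pr1: "progress j s1 = progress j st" using v1 by (intro progress_cong) auto
    let ?c = "Seq draw_samples (Seq pick_all (Seq update_covered adjust_guess))"
    show "qwp (Cond (BLess (WConst 0) (WVar vN)) (Seq (WAssign vM (WMul (WVar vL) (WVar vK))) ?c) Skip)
       (9 * ?M + n * (12 * ?M + 20) + 2 * ?k * (6 * n + 7) + 6 * ?M + 30)
       (round_inv s e E0 (Suc j)) ?g s1 ?r"
    proof (rule qwp_Cond[where T = "9 * ?M + n * (12 * ?M + 20) + 2 * ?k * (6 * n + 7) + 6 * ?M + 29"])
      assume "\<not> bval \<kappa> inp (BLess (WConst 0) (WVar vN)) s1"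
      then have "card (uncovered s1) = 0" using m v1 by (simp add: uncovered_def)
      \<comment> \<open>With nothing left uncovered the shrinkage inequality holds trivially, so an
        idle round counts as a shrinking one.\<close>
      then have "progress (Suc j) s1" if "progress j s1"
      proof -
        from that obtain a b where "a + b = j" "wvar s1 vK = 2 ^ a" by (auto simp: progress_def)
        with \<open>card (uncovered s1) = 0\<close> show ?thesis
          by (intro progressI[of a "Suc b"]) simp_all
      qed
      then show "qwp Skip (9 * ?M + n * (12 * ?M + 20) + 2 * ?k * (6 * n + 7) + 6 * ?M + 29)
         (round_inv s e E0 (Suc j)) ?g s1 ?r"
        using round_inv_Suc[OF inv1] pr1 by (intro qwp_Skip) auto
    next
      assume "bval \<kappa> inp (BLess (WConst 0) (WVar vN)) s1"
      then have m0: "0 < ?m" by simp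
      let ?s2 = "set_wvar vM ?M s1"
      let ?H = "light s ?U ?k"
      have "qwp draw_samples (9 * ?M + 3)
         (\<lambda>s'. \<forall>i<?M. warr s' aSmp i \<in> warr ?s2 aUnc ` {..<?m} \<and> warr s' aHit i = 0)
         (\<lambda>s'. ennreal (estimator ?H (hit s) ?M ?M (warr s' aSmp))) ?s2 (ennreal (card ?H / 2 ^ ?M))"
      proof (rule qwp_draw_samples)
        fix W assume W: "W \<in> ?H"
        have img: "warr s1 aUnc ` {x. x < ?m \<and> warr s1 aUnc x \<in> hit s W} = hit s W \<inter> ?U"
          using bij_betw_imp_surj_on[OF bij] by auto
        have "inj_on (warr s1 aUnc) {x. x < ?m \<and> warr s1 aUnc x \<in> hit s W}"
          by (rule inj_on_subset[OF bij_betw_imp_inj_on[OF bij]]) auto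
        from card_image[OF this]
        have "card {x. x < ?m \<and> warr s1 aUnc x \<in> hit s W} = card (hit s W \<inter> ?U)"
          unfolding img by (rule sym)
        then show "16 * card {x. x < ?m \<and> warr ?s2 aUnc x \<in> hit s W} \<le> ?m"
          using W m by (simp add: light_def)
      qed (use M m0 in auto)
      then have "qwp draw_samples (9 * ?M + 3)
         (\<lambda>s'. \<forall>i<?M. warr s' aSmp i \<in> warr ?s2 aUnc ` {..<?m} \<and> warr s' aHit i = 0)
         (\<lambda>s'. (if progress j st then 0 else 1) + ennreal (estimator ?H (hit s) ?M ?M (warr s' aSmp)))
         ?s2 ((if progress j st then 0 else 1) + ennreal (card ?H / 2 ^ ?M))"
        by (rule qwp_add_const)
      then have "qwp draw_samples (9 * ?M + 3)
         (\<lambda>s'. \<forall>i<?M. warr s' aSmp i \<in> warr ?s2 aUnc ` {..<?m} \<and> warr s' aHit i = 0)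
         (\<lambda>s'. (if progress j st then 0 else 1) + ennreal (estimator ?H (hit s) ?M ?M (warr s' aSmp)))
         ?s2 ?r"
        by (rule qwp_conseq)
           (auto simp: fail_prob_def intro!: add_left_mono ennreal_leI card_light_le lg k2 cL2)
      then have "qwp ?c (9 * ?M + 3 + (n * (12 * ?M + 20) + 2 * ?k * (6 * n + 7) + 6 * ?M + 20) + 1)
         (round_inv s e E0 (Suc j)) ?g ?s2 ?r"
      proof (rule qwp_Seq)
        fix s3 assume smp: "\<forall>i<?M. warr s3 aSmp i \<in> warr ?s2 aUnc ` {..<?m} \<and> warr s3 aHit i = 0"
          and fr3: "frame draw_samples ?s2 s3"
        have v3: "wvar s3 vS = s" "wvar s3 vL = cL * lg" "wvar s3 vK = ?k" "warr s3 aCov = warr st aCov"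
          "wvar s3 vM = ?M"
          using fr3 v1 by (simp_all add: frame_def)
        have inv3: "round_inv s e E0 j s3"
          using fr3 by (intro round_inv_cong[OF inv1]) (simp_all add: frame_def)
        have pr3: "progress j s3 = progress j st" using v3 by (intro progress_cong) auto
        have U3: "uncovered s3 = ?U" using v3 by (simp add: uncovered_def)
        have "wp (Seq pick_all (Seq update_covered adjust_guess))
           (n * (12 * ?M + 20) + 2 * ?k * (6 * n + 7) + 6 * ?M + 20)
           (\<lambda>st'. round_inv s e E0 (Suc j) st' \<and> (progress j s3 \<longrightarrow>
              \<not> misleading s (uncovered s3) ?k ?M (warr s3 aSmp) \<longrightarrow> progress (Suc j) st')) s3"
        proof (rule wp_process_samples)
          show "warr s3 aSmp i \<in> uncovered s3" "warr s3 aHit i = 0" if "i < ?M" for i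
            using smp that bij U3 by (auto simp: bij_betw_def)
        qed (use inv3 s v3 L1 M e in auto)
        then show "qwp (Seq pick_all (Seq update_covered adjust_guess))
           (n * (12 * ?M + 20) + 2 * ?k * (6 * n + 7) + 6 * ?M + 20)
           (round_inv s e E0 (Suc j)) ?g s3
           ((if progress j st then 0 else 1) + ennreal (estimator ?H (hit s) ?M ?M (warr s3 aSmp)))"
        proof (rule qwp_of_wp)
          fix s' assume post: "round_inv s e E0 (Suc j) s' \<and> (progress j s3 \<longrightarrow>
              \<not> misleading s (uncovered s3) ?k ?M (warr s3 aSmp) \<longrightarrow> progress (Suc j) s')"
          \<comment> \<open>If progress is lost in this round, the samples were misleading, and the
            estimator alone already pays for the value 1 of the potential.\<close>
          have "1 \<le> ennreal (estimator ?H (hit s) ?M ?M (warr s3 aSmp))"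
            if "misleading s ?U ?k ?M (warr s3 aSmp)"
            using that estimator_final[OF finite_light] unfolding misleading_def ennreal_1[symmetric]
            by (blast intro: ennreal_leI)
          then show "?g s' \<le> (if progress j st then 0 else 1) +
              ennreal (estimator ?H (hit s) ?M ?M (warr s3 aSmp))"
            using post pr3 U3 by (auto intro: order_trans)
        qed auto
      qed simp
      then show "qwp (Seq (WAssign vM (WMul (WVar vL) (WVar vK))) ?c)
         (9 * ?M + n * (12 * ?M + 20) + 2 * ?k * (6 * n + 7) + 6 * ?M + 29)
         (round_inv s e E0 (Suc j)) ?g s1 ?r"
        using v1 M by (rule_tac qwp_Seq_WAssign) (simp, linarith)
    qed simp
  qed (simp add: round_time_def)
  then show ?thesis
    by (rule qwp_mono_time) (rule round_time_mono[OF k2(2)])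
qed

text \<open>Doublings are limited by 2^a = k \<le> 2 \<open>opt s\<close> \<le> 2 n < 2^(lg + 1), so
  a \<le> \<open>lg\<close> and at least 11 \<open>lg\<close> of the rounds were shrinking
  ones.\<close>

lemma covers_of_progress:
  assumes "round_inv s e E0 (12 * lg) st" "progress (12 * lg) st" "s < n"
  shows "{t. t < n \<and> warr st aCov t = 0} = {}"
proof -
  obtain a b where ab: "a + b = 12 * lg" "wvar st vK = 2 ^ a" "card (uncovered st) * 16 ^ b \<le> 15 ^ b * n"
    using assms(2) by (auto simp: progress_def)
  have "2 ^ a \<le> 2 * opt s" using assms(1) ab(2) by (simp add: round_inv_def)
  also have "\<dots> < 2 ^ Suc lg" using opt_le_n[OF assms(3)] lg(1) by simp
  finally have "a < Suc lg" by (rule power_less_imp_less_exp[rotated]) simp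
  then have "card (uncovered st) = 0"
    using ab lg(1) by (intro shrunk_set_empty[of _ b n lg]) auto
  then show ?thesis using finite_uncovered[of st] by (simp add: uncovered_def)
qed

section \<open>All sources: accumulated edges and failure probability\<close>

definition source_inv :: "nat \<Rightarrow> state \<Rightarrow> bool" where
  "source_inv i st \<longleftrightarrow> out_edges st \<subseteq> {..<i} \<times> {..<n} \<and>
     (\<forall>s<i. card {u. (s, u) \<in> out_edges st} \<le> 48 * lg * opt s) \<and>
     wvar st vE \<le> (\<Sum>s<i. 48 * lg * opt s)"

definition sources_covered :: "nat \<Rightarrow> state \<Rightarrow> bool" where
  "sources_covered i st \<longleftrightarrow> (\<forall>s<i. covers s {u. (s, u) \<in> out_edges st})"

definition source_time :: "nat \<Rightarrow> nat" where
  "source_time s = 12 * lg * (round_time (2 * opt s) + 4) + 5 * n + 20"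

text \<open>The factor 48 \<open>lg\<close> is 12 \<open>lg\<close> rounds times 4
  \<open>opt s\<close> picks. With \<open>lg\<close> \<le> 2 n and \<open>opt s\<close> \<le> n the
  total is at most 96 n^3, which fits into a word.\<close>

lemma edge_count_lt: "i \<le> n \<Longrightarrow> (\<Sum>s<i. 48 * lg * opt s) + 1 < wlim"
proof -
  assume i: "i \<le> n"
  have "(\<Sum>s<i. 48 * lg * opt s) \<le> (\<Sum>s<i. 48 * (2 * n) * n)"
    using i lg_le opt_le_n by (intro sum_mono mult_mono) auto
  also have "\<dots> \<le> n * (48 * (2 * n) * n)" using i by simp
  also have "\<dots> = 96 * n ^ 3" by (simp add: power3_eq_cube)
  finally show ?thesis using wlim_gt(3) n_le_cube(3) by linarith
qed

lemma qwp_cover_source: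
  assumes inv: "source_inv s st" and s: "wvar st vS = s" "s < n"
    and L: "wvar st vL = cL * lg" and rounds: "wvar st vR = 12 * lg"
  shows "qwp cover_source (source_time s) (source_inv (Suc s))
     (\<lambda>st'. if sources_covered (Suc s) st' then 0 else 1) st
     ((if sources_covered s st then 0 else 1) + of_nat (12 * lg) * fail_prob)"
proof -
  let ?e = "wvar st vE" and ?E = "out_edges st" and ?J = "12 * lg"
  let ?a = "if sources_covered s st then 0 else 1 :: ennreal"
  \<comment> \<open>One \<open>fail_prob\<close> is held in reserve for each round still to come; a
    round spends its share on the possible loss of progress.\<close>
  let ?\<phi> = "\<lambda>j st'. of_nat (?J - j) * fail_prob + (if progress j st' then 0 else 1)"
  let ?s1 = "set_wvar vK 1 st"
  have e: "?e + 48 * lg * opt s + 1 < wlim"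
    using inv edge_count_lt[of "Suc s"] s(2) by (simp add: source_inv_def)
  have J: "?J < wlim" using lg_le wlim_gt(1) by simp
  have init: "wp (For vT WSize (WStore aCov (WVar vT) (WConst 0))) (n * 5 + 3)
     (\<lambda>s'. \<forall>t<n. warr s' aCov t = 0) ?s1"
    by (rule wp_For[where N = n and Tb = 1 and Inv = "\<lambda>j s'. \<forall>t<j. warr s' aCov t = 0"])
       (use wlim_gt in \<open>auto intro!: qwp_WStore simp: less_Suc_eq\<close>)
  have loop: "qwp (For vJ (WVar vR) cover_round) (?J * (round_time (2 * opt s) + 4) + 3)
     (source_inv (Suc s)) (\<lambda>st'. if sources_covered (Suc s) st' then 0 else 1) s2
     (?a + of_nat ?J * fail_prob)"
    if inv2: "round_inv s ?e ?E 0 s2" "progress 0 s2"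
      and v2: "wvar s2 vS = s" "wvar s2 vL = cL * lg" "wvar s2 vR = ?J" for s2
  proof -
    have "qwp (For vJ (WVar vR) cover_round) (?J * (round_time (2 * opt s) + 4) + 3)
       (\<lambda>s'. round_inv s ?e ?E ?J s' \<and> wvar s' vJ = ?J) (?\<phi> ?J) s2 (?\<phi> 0 (set_wvar vJ 0 s2))"
    proof (rule qwp_For[where Tb = "\<lambda>_. round_time (2 * opt s)"])
      show "round_inv s ?e ?E 0 (set_wvar vJ 0 s2)" by (rule round_inv_cong[OF inv2(1)]) auto
    next
      fix j s' assume j: "j < ?J" and inv': "round_inv s ?e ?E j s'" and "wvar s' vJ = j"
        and fr: "frame (For vJ (WVar vR) cover_round) s2 s'"
      have "4 * opt s * Suc j \<le> 4 * opt s * ?J" using j by (intro mult_left_mono) auto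
      then have "?e + 4 * opt s * Suc j + 1 < wlim" using e by (simp add: mult_ac)
      then have "qwp cover_round (round_time (2 * opt s)) (round_inv s ?e ?E (Suc j))
         (\<lambda>st'. if progress (Suc j) st' then 0 else 1) s' ((if progress j s' then 0 else 1) + fail_prob)"
        using fr v2 s by (intro qwp_cover_round[OF inv']) (auto simp: frame_def)
      from qwp_add_const[OF this, of "of_nat (?J - Suc j) * fail_prob"]
      show "qwp cover_round (round_time (2 * opt s)) (\<lambda>s''. round_inv s ?e ?E (Suc j) (set_wvar vJ (Suc j) s''))
         (\<lambda>s''. ?\<phi> (Suc j) (set_wvar vJ (Suc j) s'')) s' (?\<phi> j s')"
      proof (rule qwp_conseq)
        have "(of_nat (?J - j) :: ennreal) = of_nat (?J - Suc j) + 1"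
          using j by (metis Suc_diff_Suc of_nat_Suc add.commute)
        then show "of_nat (?J - Suc j) * fail_prob + ((if progress j s' then 0 else 1) + fail_prob) \<le> ?\<phi> j s'"
          by (simp add: distrib_right add_ac)
        fix s'' :: state
        have "progress (Suc j) (set_wvar vJ (Suc j) s'') = progress (Suc j) s''"
          by (rule progress_cong) auto
        then show "?\<phi> (Suc j) (set_wvar vJ (Suc j) s'')
          \<le> of_nat (?J - Suc j) * fail_prob + (if progress (Suc j) s'' then 0 else 1)" by simp
      qed (auto intro: round_inv_cong)
    qed (use v2 J in \<open>auto simp: frame_def\<close>)
    moreover have "progress 0 (set_wvar vJ 0 s2)"
      using inv2(2) progress_cong[of "set_wvar vJ 0 s2" s2 0] by simp
    ultimately have "qwp (For vJ (WVar vR) cover_round) (?J * (round_time (2 * opt s) + 4) + 3)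
       (\<lambda>s'. round_inv s ?e ?E ?J s' \<and> wvar s' vJ = ?J)
       (\<lambda>s'. ?a + ?\<phi> ?J s') s2 (?a + of_nat ?J * fail_prob)"
      by (intro qwp_add_const) simp
    then show ?thesis
    proof (rule qwp_conseq)
      fix s' assume "round_inv s ?e ?E ?J s' \<and> wvar s' vJ = ?J"
      then have inv': "round_inv s ?e ?E ?J s'" by simp
      then obtain W where W: "W \<subseteq> {..<n}" "card W \<le> 4 * opt s * ?J" "out_edges s' = ?E \<union> {s} \<times> W"
        "\<And>t. t < n \<Longrightarrow> warr s' aCov t = (if t = s \<or> t \<in> hit s W then 1 else 0)"
        unfolding round_inv_def by blast
      have Es: "?E \<subseteq> {..<s} \<times> {..<n}" using inv by (simp add: source_inv_def)
      have N1: "{u. (s, u) \<in> out_edges s'} = W" using W(3) Es by auto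
      have N2: "{u. (i, u) \<in> out_edges s'} = {u. (i, u) \<in> ?E}" if "i < s" for i
        using W(3) that by auto
      show "source_inv (Suc s) s'"
        unfolding source_inv_def
      proof (intro conjI allI impI)
        show "out_edges s' \<subseteq> {..<Suc s} \<times> {..<n}" using W(1,3) Es by auto
        show "card {u. (i, u) \<in> out_edges s'} \<le> 48 * lg * opt i" if "i < Suc s" for i
          using that N1 N2[of i] W(2) inv by (auto simp: less_Suc_eq source_inv_def mult_ac)
        show "wvar s' vE \<le> (\<Sum>s<Suc s. 48 * lg * opt s)"
          using inv inv' by (auto simp: source_inv_def round_inv_def mult_ac)
      qed
      have "sources_covered (Suc s) s'" if "sources_covered s st" "progress ?J s'"
      proof -
        have "covers s W"
          using covers_of_progress[OF inv' that(2) s(2)] W(4) by (auto simp: covers_def split: if_splits)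
        then show ?thesis using that(1) N1 N2 by (auto simp: sources_covered_def less_Suc_eq)
      qed
      then show "(if sources_covered (Suc s) s' then 0 else 1) \<le> ?a + ?\<phi> ?J s'" by auto
    qed auto
  qed
  have "qwp (Seq (For vT WSize (WStore aCov (WVar vT) (WConst 0)))
     (Seq (WStore aCov (WVar vS) (WConst 1)) (For vJ (WVar vR) cover_round)))
     (n * 5 + 3 + (?J * (round_time (2 * opt s) + 4) + 5) + 1)
     (source_inv (Suc s)) (\<lambda>st'. if sources_covered (Suc s) st' then 0 else 1) ?s1
     (?a + of_nat ?J * fail_prob)"
    using init
  proof (rule wp_Seq)
    fix s' assume cov: "\<forall>t<n. warr s' aCov t = 0"
      and fr: "frame (For vT WSize (WStore aCov (WVar vT) (WConst 0))) ?s1 s'"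
    let ?s2 = "set_warr aCov s 1 s'"
    have v: "wvar s' vS = s" "wvar s' vL = cL * lg" "wvar s' vR = ?J" "wvar s' vK = 1" "wvar s' vE = ?e"
      and E: "out_edges ?s2 = ?E"
      using fr s L rounds out_edges_cong[of ?s2 st] by (simp_all add: frame_def)
    have "round_inv s ?e ?E 0 ?s2"
      using v E cov opt_pos[OF s(2)] by (auto simp: round_inv_def)
    moreover have "card (uncovered ?s2) \<le> n"
      using card_samples_le[of n] by (simp add: uncovered_def)
    then have "progress 0 ?s2" using v by (simp add: progress_def)
    ultimately show "qwp (Seq (WStore aCov (WVar vS) (WConst 1)) (For vJ (WVar vR) cover_round))
      (?J * (round_time (2 * opt s) + 4) + 5)
      (source_inv (Suc s)) (\<lambda>st'. if sources_covered (Suc s) st' then 0 else 1) s'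
      (?a + of_nat ?J * fail_prob)"
      using v loop[of ?s2] by (intro qwp_Seq_WStore[where T = "?J * (round_time (2 * opt s) + 4) + 3"]) auto
  qed simp
  then show ?thesis
    unfolding cover_source_def by (rule_tac qwp_Seq_WAssign) (auto simp: source_time_def)
qed

text \<open>Until \<open>vX\<close> exceeds \<open>n\<close>, the exponent equals the loop counter;
  after \<open>n\<close> iterations both alternatives give n < \<open>vX\<close>, as n < 2^n. Only
  one power of two lies above \<open>n\<close> and at most at 2 n, so the exponent is
  \<open>lg\<close>.\<close>

lemma wp_bit_length: "wp bit_length (8 * n + 7) (\<lambda>st. wvar st vLg = lg) st"
proof -
  let ?c = "Cond (BLess WSize (WVar vX)) Skip (Seq (WAssign vX (WAdd (WVar vX) (WVar vX))) (incr vLg))"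
  let ?s = "set_wvar vLg 0 (set_wvar vX 1 st)"
  have "wp (For vI WSize ?c) (n * 8 + 3) (\<lambda>st. wvar st vLg = lg) ?s"
  proof (rule wp_For[where N = n and Tb = 4 and Inv = "\<lambda>j s'. wvar s' vX = 2 ^ wvar s' vLg \<and>
      wvar s' vX \<le> 2 * n \<and> (n < wvar s' vX \<or> wvar s' vLg = j)"])
    fix j and s' :: state assume inv: "wvar s' vX = 2 ^ wvar s' vLg \<and> wvar s' vX \<le> 2 * n \<and>
      (n < wvar s' vX \<or> wvar s' vLg = j)" and j: "j < n"
    have "wvar s' vLg < wvar s' vX" using inv less_exp by simp
    then have lim: "wvar s' vLg + 1 < wlim" "2 * wvar s' vX < wlim" using inv wlim_gt(1) by linarith+
    show "wp ?c 4 (\<lambda>s''. wvar (set_wvar vI (Suc j) s'') vX = 2 ^ wvar (set_wvar vI (Suc j) s'') vLg \<and>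
      wvar (set_wvar vI (Suc j) s'') vX \<le> 2 * n \<and>
      (n < wvar (set_wvar vI (Suc j) s'') vX \<or> wvar (set_wvar vI (Suc j) s'') vLg = Suc j)) s'"
      using inv lim
      by (intro qwp_Cond[where T = 3] qwp_Skip qwp_Seq_WAssign[where T = 1] qwp_incr) auto
  next
    fix s' :: state assume inv: "wvar s' vX = 2 ^ wvar s' vLg \<and> wvar s' vX \<le> 2 * n \<and>
      (n < wvar s' vX \<or> wvar s' vLg = n)"
    then have "n < 2 ^ wvar s' vLg" "2 ^ wvar s' vLg \<le> 2 * n" using less_exp[of n] by auto
    then have "(2::nat) ^ lg < 2 ^ Suc (wvar s' vLg)" "(2::nat) ^ wvar s' vLg < 2 ^ Suc lg"
      using lg by auto
    then show "wvar s' vLg = lg"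
      by (metis le_antisym less_Suc_eq_le numeral_eq_iff one_less_numeral_iff
          power_less_imp_less_exp semiring_norm(76))
  qed (use n2 wlim_gt in auto)
  then show ?thesis
    unfolding bit_length_def
    by (intro qwp_Seq_WAssign[where T = "n * 8 + 5"] qwp_Seq_WAssign[where T = "n * 8 + 3"]) simp_all
qed

definition total_time :: nat where
  "total_time = (\<Sum>s<n. source_time s + 4) + 8 * n + 20"

text \<open>The reserve is now one \<open>fail_prob\<close> for each of the 12 \<open>lg\<close>
  rounds of each of the \<open>n\<close> sources; this is the union bound over all rounds of the
  run.\<close>

lemma qwp_nav_prog:
  "qwp (nav_prog cL) total_time (source_inv n) (\<lambda>st. if sources_covered n st then 0 else 1)
     init_state (of_nat (n * (12 * lg)) * fail_prob)"
proof -
  let ?\<phi> = "\<lambda>i st. of_nat ((n - i) * (12 * lg)) * fail_prob + (if sources_covered i st then 0 else 1)"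
  have loop: "qwp (For vS WSize cover_source) ((\<Sum>s<n. source_time s + 4) + 3)
     (\<lambda>st. source_inv n st \<and> wvar st vS = n) (?\<phi> n) st (?\<phi> 0 (set_wvar vS 0 st))"
    if st: "wvar st vE = 0" "wvar st vL = cL * lg" "wvar st vR = 12 * lg" for st
  proof (rule qwp_For[where Tb = source_time and Inv = source_inv and N = n and \<phi> = ?\<phi>])
    show "source_inv 0 (set_wvar vS 0 st)" using st by (simp add: source_inv_def out_edges_def)
  next
    fix i s' assume i: "i < n" and inv: "source_inv i s'" and s: "wvar s' vS = i"
      and fr: "frame (For vS WSize cover_source) st s'"
    have "qwp cover_source (source_time i) (source_inv (Suc i))
      (\<lambda>st'. if sources_covered (Suc i) st' then 0 else 1) s'
      ((if sources_covered i s' then 0 else 1) + of_nat (12 * lg) * fail_prob)"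
      using fr st by (intro qwp_cover_source[OF inv s i]) (auto simp: frame_def)
    from qwp_add_const[OF this, of "of_nat ((n - Suc i) * (12 * lg)) * fail_prob"]
    show "qwp cover_source (source_time i) (\<lambda>s''. source_inv (Suc i) (set_wvar vS (Suc i) s''))
      (\<lambda>s''. ?\<phi> (Suc i) (set_wvar vS (Suc i) s'')) s' (?\<phi> i s')"
    proof (rule qwp_conseq)
      have "(n - i) * (12 * lg) = (n - Suc i) * (12 * lg) + 12 * lg"
        using i by (metis Suc_diff_Suc add.commute mult_Suc)
      then have "(of_nat ((n - i) * (12 * lg)) :: ennreal) =
          of_nat ((n - Suc i) * (12 * lg)) + of_nat (12 * lg)"
        by (metis of_nat_add)
      then show "of_nat ((n - Suc i) * (12 * lg)) * fail_prob +
         ((if sources_covered i s' then 0 else 1) + of_nat (12 * lg) * fail_prob) \<le> ?\<phi> i s'"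
        by (simp only: distrib_right add_ac order_refl)
      fix s'' assume post: "source_inv (Suc i) s''"
      have "out_edges (set_wvar vS (Suc i) s'') = out_edges s''" by (rule out_edges_cong) auto
      then show "?\<phi> (Suc i) (set_wvar vS (Suc i) s'') \<le> of_nat ((n - Suc i) * (12 * lg)) * fail_prob +
          (if sources_covered (Suc i) s'' then 0 else 1)"
        and "source_inv (Suc i) (set_wvar vS (Suc i) s'')"
        using post by (simp_all add: sources_covered_def source_inv_def)
    qed simp
  qed (use wlim_gt in auto)
  show ?thesis
    unfolding nav_prog_def
  proof (rule wp_Seq[OF wp_bit_length, where ?T2.0 = "(\<Sum>s<n. source_time s + 4) + 7"])
    fix s1 assume l: "wvar s1 vLg = lg" and fr: "frame bit_length init_state s1"
    have "cL * lg * 1 \<le> cL * (2 * n) * n" using lg_le n2 by (intro mult_mono) auto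
    also have "\<dots> = 2 * (cL * n * n)" by simp
    finally have "cL * lg < wlim" using wlim_gt(4) unfolding mult.assoc by linarith
    moreover have "12 * lg < wlim" using lg_le wlim_gt(1) by simp
    moreover have "wvar s1 vE = 0" using fr by (simp add: frame_def init_state_def)
    moreover have "sources_covered 0 st" for st by (simp add: sources_covered_def)
    ultimately have "qwp (For vS WSize cover_source) ((\<Sum>s<n. source_time s + 4) + 3)
       (source_inv n) (\<lambda>st. if sources_covered n st then 0 else 1)
       (set_wvar vR (12 * lg) (set_wvar vL (cL * lg) s1)) (of_nat (n * (12 * lg)) * fail_prob)"
      by (intro qwp_conseq[OF loop]) simp_all
    then show "qwp (Seq (WAssign vL (WMul (WConst cL) (WVar vLg)))
     (Seq (WAssign vR (WMul (WConst 12) (WVar vLg))) (For vS WSize cover_source)))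
     ((\<Sum>s<n. source_time s + 4) + 7)
     (source_inv n) (\<lambda>st. if sources_covered n st then 0 else 1) s1 (of_nat (n * (12 * lg)) * fail_prob)"
      using l \<open>cL * lg < wlim\<close> \<open>12 * lg < wlim\<close>
      by (intro qwp_Seq_WAssign[where T = "(\<Sum>s<n. source_time s + 4) + 5"]
          qwp_Seq_WAssign[where T = "(\<Sum>s<n. source_time s + 4) + 3"]) simp_all
  qed (simp add: total_time_def)
qed

section \<open>Explicit bounds in terms of n\<close>

lemma round_time_le:
  assumes "s < n" shows "round_time (2 * opt s) + 4 \<le> 130 * (cL + 1) * (lg * n * opt s)"
proof -
  let ?p = "lg * n * opt s"
  have o: "1 \<le> opt s" "1 \<le> lg" "1 \<le> n" using opt_pos[OF assms] lg_pos n2 by auto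
  have "1 * n * 1 \<le> ?p" "1 * 1 * 1 \<le> ?p" "1 * 1 * opt s \<le> ?p" "1 * n * opt s \<le> ?p"
    "lg * 1 * opt s \<le> ?p"
    using o by (intro mult_mono; simp)+
  then have le: "n \<le> ?p" "1 \<le> ?p" "opt s \<le> ?p" "n * opt s \<le> ?p" "cL * (lg * opt s) \<le> cL * ?p"
    by simp_all
  have "round_time (2 * opt s) + 4 =
      28 * n + 24 * (n * opt s) + 28 * opt s + 44 + 30 * (cL * (lg * opt s)) + 24 * (cL * ?p)"
    unfolding round_time_def by (simp add: algebra_simps)
  also have "\<dots> \<le> 124 * ?p + 54 * (cL * ?p)" using le by linarith
  also have "\<dots> \<le> 130 * (cL + 1) * ?p" by (simp add: algebra_simps)
  finally show ?thesis .
qed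

text \<open>One factor \<open>lg\<close> comes from the number of rounds and one from the sample
  size. The remaining \<open>n * opt s\<close> is summed over the sources by
  \<open>sum_opt_le_OPT_size\<close>.\<close>

lemma total_time_le: "total_time \<le> 1700 * (cL + 1) * lg ^ 2 * n * OPT_size {..<n} d \<alpha>"
proof -
  have l: "1 \<le> lg ^ 2" using lg_pos by simp
  have src: "source_time s + 4 \<le> 1600 * (cL + 1) * lg ^ 2 * n * opt s" if s: "s < n" for s
  proof -
    let ?q = "(cL + 1) * lg ^ 2 * n * opt s"
    have o: "1 \<le> opt s" "1 \<le> n" using opt_pos[OF s] n2 by auto
    have "1 * 1 * n * 1 \<le> ?q" "1 * 1 * 1 * 1 \<le> ?q"
      using o l by (intro mult_mono; simp)+
    moreover have "12 * lg * (round_time (2 * opt s) + 4) \<le> 12 * lg * (130 * (cL + 1) * (lg * n * opt s))"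
      by (intro mult_left_mono round_time_le s) simp
    moreover have "12 * lg * (130 * (cL + 1) * (lg * n * opt s)) = 1560 * ?q"
      by (simp add: power2_eq_square algebra_simps)
    ultimately have "source_time s + 4 \<le> 1600 * ?q" unfolding source_time_def by linarith
    then show ?thesis by (simp only: mult.assoc)
  qed
  let ?S = "\<Sum>s<n. opt s"
  let ?q = "(cL + 1) * lg ^ 2 * n * ?S"
  have "(\<Sum>s<n. 1) \<le> ?S" using opt_pos by (intro sum_mono) auto
  then have "1 \<le> ?S" using n2 by simp
  then have q: "1 * 1 * n * 1 \<le> ?q" using l by (intro mult_mono) auto
  have "(\<Sum>s<n. source_time s + 4) \<le> (\<Sum>s<n. 1600 * (cL + 1) * lg ^ 2 * n * opt s)"
    using src by (intro sum_mono) auto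
  also have "\<dots> = 1600 * ?q" by (simp only: sum_distrib_left mult.assoc)
  finally have "total_time \<le> 1700 * ?q" unfolding total_time_def using q n2 by linarith
  also have "\<dots> \<le> 1700 * ((cL + 1) * lg ^ 2 * n * OPT_size {..<n} d \<alpha>)"
    by (intro mult_left_mono sum_opt_le_OPT_size) auto
  finally show ?thesis by (simp only: mult.assoc)
qed

text \<open>From 2^lg \<le> 2 n follows lg ln 2 \<le> ln 2 + ln n \<le> 2 ln n, and ln 2 \<ge> 2/3
  gives the factor 3.\<close>

lemma lg_le_ln: "real lg \<le> 3 * ln (real n)"
proof -
  have "real lg * ln 2 = ln (2 ^ lg)" by (simp add: ln_realpow)
  also have "\<dots> \<le> ln (2 * real n)"
  proof (subst ln_le_cancel_iff)
    show "2 ^ lg \<le> 2 * real n" using lg(2) by (metis of_nat_le_iff of_nat_mult of_nat_numeral of_nat_power)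
  qed (use n2 in auto)
  also have "\<dots> = ln 2 + ln (real n)" using n2 by (simp add: ln_mult)
  also have "\<dots> \<le> 2 * ln (real n)" using n2 by simp
  finally have "real lg * ln 2 \<le> 2 * ln (real n)" .
  moreover have "real lg * (2 / 3) \<le> real lg * ln 2"
    using ln2_ge_two_thirds by (intro mult_left_mono) auto
  ultimately show ?thesis by simp
qed

text \<open>After the two units spent on the union bound over families, c + 7 remain and give n^-(c
  + 7) per round. The 12 n lg \<le> 24 n^2 rounds are at most n^7, because 24 \<le> 2^5 \<le>
  n^5.\<close>

lemma total_fail_prob_le:
  assumes "cL = c + 9"
  shows "of_nat (n * (12 * lg)) * fail_prob \<le> ennreal (1 / real n ^ c)"
proof -
  have n0: "real n > 0" using n2 by simp
  have "(1 / 2 :: real) ^ ((cL - 2) * lg) = 1 / (2 ^ lg) ^ (c + 7)"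
    using assms by (simp add: power_one_over power_mult[symmetric] mult.commute)
  also have "\<dots> \<le> 1 / real n ^ (c + 7)"
  proof (intro divide_left_mono power_mono)
    show "real n \<le> 2 ^ lg" using lg(1) by (metis less_imp_le of_nat_le_iff of_nat_numeral of_nat_power)
  qed (use n0 in auto)
  finally have eps: "(1 / 2 :: real) ^ ((cL - 2) * lg) \<le> 1 / real n ^ (c + 7)" .
  have "real (n * (12 * lg)) \<le> 24 * real n ^ 2"
  proof -
    have "n * (12 * lg) \<le> n * (12 * (2 * n))" using lg_le by (intro mult_left_mono) auto
    then have "real (n * (12 * lg)) \<le> real (n * (12 * (2 * n)))" by (simp only: of_nat_le_iff)
    then show ?thesis by (simp add: power2_eq_square)
  qed
  also have "\<dots> \<le> real n ^ 5 * real n ^ 2"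
  proof (rule mult_right_mono)
    have "(2::real) ^ 5 \<le> real n ^ 5" using n2 by (intro power_mono) auto
    then show "24 \<le> real n ^ 5" by simp
  qed simp
  finally have "real (n * (12 * lg)) \<le> real n ^ 7" by (simp add: power_add[symmetric])
  then have "real (n * (12 * lg)) * (1 / 2) ^ ((cL - 2) * lg) \<le> real n ^ 7 * (1 / real n ^ (c + 7))"
    using eps by (intro mult_mono) auto
  also have "\<dots> = 1 / real n ^ c" using n0 by (simp add: power_add)
  finally have "ennreal (real (n * (12 * lg)) * (1 / 2) ^ ((cL - 2) * lg)) \<le> ennreal (1 / real n ^ c)"
    by (rule ennreal_leI)
  then show ?thesis
    by (simp add: fail_prob_def ennreal_mult ennreal_of_nat_eq_real_of_nat)
qed

lemma approx_of_source_inv: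
  assumes "source_inv n st" "sources_covered n st"
  shows "approx_sparsest_deg {..<n} d \<alpha> (144 * ln (real n)) (out_edges st)"
    and "approx_sparsest_size {..<n} d \<alpha> (144 * ln (real n)) (out_edges st)"
proof -
  have nav: "navigable {..<n} d \<alpha> (out_edges st)"
    using assms by (simp add: navigable_iff source_inv_def sources_covered_def)
  have deg: "real (card {u. (s, u) \<in> out_edges st}) \<le> 144 * ln (real n) * real (opt s)" if "s < n" for s
  proof -
    have "card {u. (s, u) \<in> out_edges st} \<le> 48 * lg * opt s"
      using assms(1) that by (simp add: source_inv_def)
    then have "real (card {u. (s, u) \<in> out_edges st}) \<le> real (48 * lg * opt s)"
      by (simp only: of_nat_le_iff)
    also have "\<dots> = 48 * real lg * real (opt s)" by simp
    also have "\<dots> \<le> 48 * (3 * ln (real n)) * real (opt s)"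
      using lg_le_ln by (intro mult_right_mono mult_left_mono) auto
    finally show ?thesis by simp
  qed
  have "0 \<le> 144 * ln (real n)" using n2 by simp
  from approx_sparsest_of_outdeg[OF nav deg this]
  show "approx_sparsest_deg {..<n} d \<alpha> (144 * ln (real n)) (out_edges st)"
    "approx_sparsest_size {..<n} d \<alpha> (144 * ln (real n)) (out_edges st)" by auto
qed

end

lemma (in ram) prob_ge_of_qwp:
  assumes "qwp c T Q (\<lambda>s. if G s then 0 else 1) s (ennreal p)" "0 \<le> p"
    and "\<And>s. Q s \<Longrightarrow> G s \<Longrightarrow> snd -` {s} \<subseteq> A"
  shows "measure_pmf.prob (steps \<kappa> I T (c, s)) A \<ge> 1 - p"
proof -
  let ?D = "steps \<kappa> I T (c, s)"
  let ?B = "{cfg. \<not> G (snd cfg)}"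
  have "emeasure ?D ?B = (\<integral>\<^sup>+cfg. indicator ?B cfg \<partial>measure_pmf ?D)" by simp
  also have "\<dots> = (\<integral>\<^sup>+cfg. (if G (snd cfg) then 0 else 1) \<partial>measure_pmf ?D)"
    by (intro nn_integral_cong) (simp add: indicator_def)
  also have "\<dots> \<le> ennreal p" using assms(1) by (simp add: qwp_def)
  finally have "measure_pmf.prob ?D ?B \<le> p"
    using assms(2) by (simp add: measure_pmf.emeasure_eq_measure)
  moreover have "measure_pmf.prob ?D (UNIV - ?B) = 1 - measure_pmf.prob ?D ?B"
    using measure_pmf.prob_compl[of ?B ?D] by simp
  moreover have "measure_pmf.prob ?D (UNIV - ?B) \<le> measure_pmf.prob ?D A"
    using assms(1,3) by (intro measure_pmf.finite_measure_mono_AE AE_pmfI) (auto simp: qwp_def)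
  ultimately show ?thesis by linarith
qed

text \<open>Three units of the multiplier hold n^3. The constant m = 100 (cL + 1) is absorbed by m
  further units, since m < 2^m and the base is at least 2; the multiplier is thus independent of
  \<open>n\<close>.\<close>

lemma word_size_sufficient:
  assumes "n < 2 ^ (floor_log n + 1)" "0 < n"
  shows "100 * (cL + 1) * n ^ 3 <
    wmod (3 + 100 * (cL + 1)) \<lparr>num_points = n, stretch = \<alpha>, distance = d\<rparr>"
proof -
  let ?m = "100 * (cL + 1)" and ?b = "2 ^ (floor_log n + 1) :: nat"
  have "?m < 2 ^ ?m" by (rule less_exp)
  also have "\<dots> \<le> ?b ^ ?m" by (intro power_mono) simp_all
  finally have "?m < ?b ^ ?m" .
  moreover have "n ^ 3 \<le> ?b ^ 3" using assms(1) by (intro power_mono) auto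
  ultimately have "?m * n ^ 3 < ?b ^ ?m * ?b ^ 3"
    using assms(2) by (intro mult_less_le_imp_less) auto
  also have "\<dots> = ?b ^ (3 + ?m)" by (simp add: power_add mult.commute)
  also have "\<dots> = wmod (3 + ?m) \<lparr>num_points = n, stretch = \<alpha>, distance = d\<rparr>"
    unfolding wmod_def by (simp only: power_mult[symmetric] mult.commute input.simps)
  finally show ?thesis .
qed

theorem theorem5p1:
  shows "\<forall>c::nat. \<exists>(prog::com) (\<kappa>::nat) (A::real) (C::real) (b::nat).
    \<forall>(n::nat) (d :: nat \<Rightarrow> nat \<Rightarrow> real) (\<alpha>::real).
      n \<ge> 2 \<longrightarrow> Metric_space {..<n} d \<longrightarrow> \<alpha> \<ge> 1 \<longrightarrow>
      (let I = \<lparr>num_points = n, stretch = \<alpha>, distance = d\<rparr> in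
       \<exists>T::nat.
         real T \<le> C * (real n * real (OPT_size {..<n} d \<alpha>)) * ln (real n) ^ b \<and>
         halts_within \<kappa> prog I T \<and>
         measure_pmf.prob (run \<kappa> prog I T)
           {cfg. approx_sparsest_deg {..<n} d \<alpha> (A * ln (real n)) (out_edges (snd cfg)) \<and>
                 approx_sparsest_size {..<n} d \<alpha> (A * ln (real n)) (out_edges (snd cfg))}
         \<ge> 1 - 1 / real n ^ c)"
\<comment> \<open>The witnesses are left open before \<open>n\<close>, \<open>d\<close> and
  \<open>\<alpha>\<close> are fixed and are determined by the final \<open>show\<close>; they can
  depend on \<open>c\<close> alone. There 144 = 48 * 3 and 15300 = 1700 * 3^2, the powers of 3
  coming from \<open>lg_le_ln\<close>.\<close>
proof (rule allI, rule exI, rule exI, rule exI, rule exI, rule exI, intro allI impI)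
  fix c n :: nat and d :: "nat \<Rightarrow> nat \<Rightarrow> real" and \<alpha> :: real
  assume n: "n \<ge> 2" and metric: "Metric_space {..<n} d" and \<alpha>: "\<alpha> \<ge> 1"
  let ?cL = "c + 9"
  let ?\<kappa> = "3 + 100 * (?cL + 1)" and ?lg = "floor_log n + 1"
  let ?I = "\<lparr>num_points = n, stretch = \<alpha>, distance = d\<rparr>"
  have fl: "n < 2 ^ ?lg" using floor_log_exp2_gt[of n] by simp
  have fl': "2 ^ ?lg \<le> 2 * n" using floor_log_exp2_le[of n] n by simp
  have "100 * (?cL + 1) * n ^ 3 < wmod ?\<kappa> ?I" using n by (intro word_size_sufficient[OF fl]) simp
  then interpret nav_ram n d \<alpha> ?\<kappa> ?cL ?lg
    using n metric \<alpha> fl fl' by (intro nav_ram.intro nav_instance.intro nav_ram_axioms.intro) simp_all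
  have "real total_time \<le> real (1700 * (?cL + 1) * ?lg ^ 2 * n * OPT_size {..<n} d \<alpha>)"
    using total_time_le by (simp only: of_nat_le_iff)
  also have "\<dots> = 1700 * real (?cL + 1) * (real n * real (OPT_size {..<n} d \<alpha>)) * real ?lg ^ 2"
    by simp
  also have "\<dots> \<le> 1700 * real (?cL + 1) * (real n * real (OPT_size {..<n} d \<alpha>)) * (3 * ln (real n)) ^ 2"
    by (intro mult_left_mono power_mono lg_le_ln) auto
  finally have time: "real total_time \<le>
      15300 * real (?cL + 1) * (real n * real (OPT_size {..<n} d \<alpha>)) * ln (real n) ^ 2"
    unfolding power_mult_distrib by (simp add: algebra_simps)
  have q: "qwp (nav_prog ?cL) total_time (source_inv n) (\<lambda>st. if sources_covered n st then 0 else 1)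
     init_state (ennreal (1 / real n ^ c))"
    by (rule qwp_conseq[OF qwp_nav_prog]) (use total_fail_prob_le[of c] in auto)
  then have halts: "halts_within ?\<kappa> (nav_prog ?cL) ?I total_time"
    unfolding halts_within_def run_def qwp_def by blast
  have "measure_pmf.prob (run ?\<kappa> (nav_prog ?cL) ?I total_time)
     {cfg. approx_sparsest_deg {..<n} d \<alpha> (144 * ln (real n)) (out_edges (snd cfg)) \<and>
           approx_sparsest_size {..<n} d \<alpha> (144 * ln (real n)) (out_edges (snd cfg))}
     \<ge> 1 - 1 / real n ^ c"
    unfolding run_def by (rule prob_ge_of_qwp[OF q]) (auto simp: approx_of_source_inv)
  with time halts show "let I = ?I in \<exists>T. real T \<le> 15300 * real (?cL + 1) *
      (real n * real (OPT_size {..<n} d \<alpha>)) * ln (real n) ^ 2 \<and>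
      halts_within ?\<kappa> (nav_prog ?cL) I T \<and>
      measure_pmf.prob (run ?\<kappa> (nav_prog ?cL) I T)
           {cfg. approx_sparsest_deg {..<n} d \<alpha> (144 * ln (real n)) (out_edges (snd cfg)) \<and>
                 approx_sparsest_size {..<n} d \<alpha> (144 * ln (real n)) (out_edges (snd cfg))}
         \<ge> 1 - 1 / real n ^ c"
    unfolding Let_def by blast
qed

end
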